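(* Let $r>1$ and $\alpha\in k^\times$. For each $\beta\in k$, the element $C-\beta$ generates a maximal submodule of $\Delta_\alpha$, where $$C=\prod_{\zeta\in\Xi}\ \prod_{a=1}^p\bigl(y-(\zeta+a)x\bigr)$$ (the inner product being taken with $a=1,\dots,p$ from left to right, the outer product in any order). Thus the dimension over $k$ of the simple $H_{g_1}$-modules over the smooth locus is $q$.
   Context: Let $p$ be an odd prime, $q=p^r$, $k=\overline{\mathbb F}_q$, and $E=\left\{\begin{pmatrix}1&a\\0&1\end{pmatrix}: a\in\mathbb F_q\right\}\cong(\mathbb Z/p)^r$. Let $\xi$ generate $\mathbb F_q^\times$; $\Xi$ is the $\mathbb F_p$-linear span of $\xi,\xi^2,\dots,\xi^{r-1}$ in $\mathbb F_q$. Put $g_i=\begin{pmatrix}1&\xi^{i-1}\\0&1\end{pmatrix}$ for $i=1,\dots,r$, so that $g_1=\begin{pmatrix}1&1\\0&1\end{pmatrix}$. $E$ acts on $k\langle x,y\rangle$ by algebra automorphisms, $\begin{pmatrix}1&a\\0&1\end{pmatrix}$ fixing $x$ and sending $y\mapsto y+ax$; $k\langle x,y\rangle\rtimes E$ is the smash product, and $H_{g_1}=(k\langle x,y\rangle\rtimes E)/(xy-yx-g_1)$. Modules are left modules, and $\Delta_\alpha=H_{g_1}/\bigl(H_{g_1}(x-\alpha)+\sum_{i=1}^rH_{g_1}(g_i-1)\bigr)$; "generates a submodule of $\Delta_\alpha$" refers to the image in $\Delta_\alpha$. The center of $H_{g_1}$ is (by the paper) isomorphic to $k[A,B,C]/(A^p-B^2)$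 with $B$ corresponding to $x^p$, so its spectrum is singular exactly along the line $A=B=0$; the simple modules over the smooth locus are those on which $x^p$ acts by a nonzero scalar. *)

theory Defs
  imports
    "HOL-Algebra.Algebraic_Closure_Type"
    "HOL-Algebra.QuotRing"
    "HOL-Algebra.Module"
    "HOL-Library.Poly_Mapping"
    "HOL-Library.FuncSet"
    "HOL-Computational_Algebra.Primes"
begin

section \<open>Left modules over a not necessarily commutative ring\<close>

text \<open>
  The locale \<^locale>\<open>module\<close> requires a commutative ring. We keep its record type (whose fields
  for a product and a unit of the module are ignored) and its axioms, over an arbitrary ring.
  The library's \<^locale>\<open>submodule\<close> does not refer to commutativity and is used as it is.
\<close>

locale left_module = R?: ring R + M?: abelian_group M
  for R :: "('a, 'c) ring_scheme" (structure) and M :: "('a, 'b, 'd) module_scheme" (structure) +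
  assumes smult_closed:
      "a \<in> carrier R \<Longrightarrow> v \<in> carrier M \<Longrightarrow> a \<odot>\<^bsub>M\<^esub> v \<in> carrier M"
    and smult_l_distr:
      "a \<in> carrier R \<Longrightarrow> b \<in> carrier R \<Longrightarrow> v \<in> carrier M \<Longrightarrow>
        (a \<oplus>\<^bsub>R\<^esub> b) \<odot>\<^bsub>M\<^esub> v = a \<odot>\<^bsub>M\<^esub> v \<oplus>\<^bsub>M\<^esub> b \<odot>\<^bsub>M\<^esub> v"
    and smult_r_distr:
      "a \<in> carrier R \<Longrightarrow> v \<in> carrier M \<Longrightarrow> w \<in> carrier M \<Longrightarrow>
        a \<odot>\<^bsub>M\<^esub> (v \<oplus>\<^bsub>M\<^esub> w) = a \<odot>\<^bsub>M\<^esub> v \<oplus>\<^bsub>M\<^esub> a \<odot>\<^bsub>M\<^esub> w"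
    and smult_assoc1:
      "a \<in> carrier R \<Longrightarrow> b \<in> carrier R \<Longrightarrow> v \<in> carrier M \<Longrightarrow>
        (a \<otimes>\<^bsub>R\<^esub> b) \<odot>\<^bsub>M\<^esub> v = a \<odot>\<^bsub>M\<^esub> (b \<odot>\<^bsub>M\<^esub> v)"
    and smult_one:
      "v \<in> carrier M \<Longrightarrow> \<one>\<^bsub>R\<^esub> \<odot>\<^bsub>M\<^esub> v = v"

definition simple_left_module ::
    "('a, 'c) ring_scheme \<Rightarrow> ('a, 'b, 'd) module_scheme \<Rightarrow> bool" where
  "simple_left_module R M \<longleftrightarrow> left_module R M \<and> carrier M \<noteq> {\<zero>\<^bsub>M\<^esub>} \<and>
     (\<forall>N. submodule N R M \<longrightarrow> N = {\<zero>\<^bsub>M\<^esub>} \<or> N = carrier M)"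

definition maximal_submodule ::
    "'b set \<Rightarrow> ('a, 'c) ring_scheme \<Rightarrow> ('a, 'b, 'd) module_scheme \<Rightarrow> bool" where
  "maximal_submodule N R M \<longleftrightarrow> submodule N R M \<and> N \<noteq> carrier M \<and>
     (\<forall>N'. submodule N' R M \<and> N \<subseteq> N' \<longrightarrow> N' = N \<or> N' = carrier M)"

definition generated_submodule ::
    "('a, 'c) ring_scheme \<Rightarrow> ('a, 'b, 'd) module_scheme \<Rightarrow> 'b set \<Rightarrow> 'b set" where
  "generated_submodule R M S = \<Inter>{N. submodule N R M \<and> S \<subseteq> N}"

text \<open>The left module \<open>R/L\<close> for a left ideal \<open>L\<close>, with \<open>a \<odot> (L + u) = L + a u\<close>.\<close>

definition left_quotient :: "('a, 'c) ring_scheme \<Rightarrow> 'a set \<Rightarrow> ('a, 'a set) module" where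
  "left_quotient R L =
    \<lparr>carrier = a_rcosets\<^bsub>R\<^esub> L, monoid.mult = undefined, one = undefined,
     zero = L, add = set_add R,
     module.smult = (\<lambda>a U. (\<Union>u\<in>U. L +>\<^bsub>R\<^esub> (a \<otimes>\<^bsub>R\<^esub> u)))\<rparr>"

definition list_product :: "('a, 'c) monoid_scheme \<Rightarrow> 'a list \<Rightarrow> 'a" where
  "list_product R us = foldr (monoid.mult R) us \<one>\<^bsub>R\<^esub>"


section \<open>The free algebra on two generators and the action of E on it\<close>

text \<open>
  The finite field \<open>\<F>\<^sub>q\<close> is a type \<open>'f\<close> of sort \<open>{finite, field}\<close>, and \<open>k\<close> is its algebraic
  closure \<open>'f alg_closure\<close>. The free algebra on \<open>x, y\<close> is the monoid algebra over \<open>k\<close>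
  of the monoid of words, written additively because \<open>\<Rightarrow>\<^sub>0\<close> forms monoid algebras of
  additive monoids.
\<close>

datatype letter = LX | LY

datatype word = Word (letters: "letter list")

instantiation word :: monoid_add
begin
definition zero_word :: word where "zero_word = Word []"
definition plus_word :: "word \<Rightarrow> word \<Rightarrow> word" where
  "plus_word u v = Word (letters u @ letters v)"
instance by standard (simp_all add: zero_word_def plus_word_def)
end

type_synonym 'f free_algebra = "word \<Rightarrow>\<^sub>0 'f alg_closure"

definition free_const :: "'f alg_closure \<Rightarrow> 'f::field free_algebra" where
  "free_const c = Poly_Mapping.single 0 c"

definition free_x :: "'f::field free_algebra" where
  "free_x = Poly_Mapping.single (Word [LX]) 1"

definition free_y :: "'f::field free_algebra" where
  "free_y = Poly_Mapping.single (Word [LY]) 1"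

text \<open>
  The group \<open>E\<close> is identified with the additive group of \<open>\<F>\<^sub>q\<close>, the element \<open>a\<close> standing for
  the unipotent matrix with upper right entry \<open>a\<close>; matrix multiplication becomes addition.
  Then \<open>act a\<close> is the algebra endomorphism with \<open>x \<mapsto> x\<close> and \<open>y \<mapsto> y + a x\<close>.
\<close>

fun act_letter :: "'f::field \<Rightarrow> letter \<Rightarrow> 'f free_algebra" where
  "act_letter a LX = free_x"
| "act_letter a LY = free_y + free_const (to_ac a) * free_x"

definition act :: "'f::field \<Rightarrow> 'f free_algebra \<Rightarrow> 'f free_algebra" where
  "act a f = (\<Sum>w\<in>Poly_Mapping.keys f.
     free_const (Poly_Mapping.lookup f w) * prod_list (map (act_letter a) (letters w)))"


section \<open>The smash product and its quotient H_alg\<close>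

text \<open>
  A function \<open>F\<close> stands for the sum of all \<open>F a \<cdot> g\<close>, where \<open>g \<in> E\<close> corresponds to \<open>a\<close>; the
  product is determined by \<open>(f g) (f' g') = f act\<^sub>g(f') g g'\<close>.
\<close>

definition smash_product :: "('f::{finite, field} \<Rightarrow> 'f free_algebra) ring" where
  "smash_product =
    \<lparr>carrier = UNIV,
     monoid.mult = (\<lambda>F G c. \<Sum>a\<in>UNIV. F a * act a (G (c - a))),
     one = (\<lambda>c. if c = 0 then 1 else 0),
     zero = (\<lambda>c. 0),
     add = (\<lambda>F G c. F c + G c)\<rparr>"

definition smash_of_free ::
    "'f::{finite, field} free_algebra \<Rightarrow> 'f \<Rightarrow> 'f free_algebra" where
  "smash_of_free f = (\<lambda>c. if c = 0 then f else 0)"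

definition smash_of_group :: "'f::{finite, field} \<Rightarrow> 'f \<Rightarrow> 'f free_algebra" where
  "smash_of_group a = (\<lambda>c. if c = a then 1 else 0)"

definition H_ideal :: "('f::{finite, field} \<Rightarrow> 'f free_algebra) set" where
  "H_ideal = Idl\<^bsub>smash_product\<^esub>
     {smash_of_free (free_x * free_y - free_y * free_x)
        \<ominus>\<^bsub>smash_product\<^esub> smash_of_group 1}"

type_synonym 'f H_elem = "('f \<Rightarrow> 'f free_algebra) set"

definition H_alg :: "'f::{finite, field} H_elem ring" where
  "H_alg = smash_product Quot H_ideal"

definition H_const :: "'f::{finite, field} alg_closure \<Rightarrow> 'f H_elem" where
  "H_const c = H_ideal +>\<^bsub>smash_product\<^esub> smash_of_free (free_const c)"

definition H_x :: "'f::{finite, field} H_elem" where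
  "H_x = H_ideal +>\<^bsub>smash_product\<^esub> smash_of_free free_x"

definition H_y :: "'f::{finite, field} H_elem" where
  "H_y = H_ideal +>\<^bsub>smash_product\<^esub> smash_of_free free_y"

definition H_group :: "'f::{finite, field} \<Rightarrow> 'f H_elem" where
  "H_group a = H_ideal +>\<^bsub>smash_product\<^esub> smash_of_group a"

text \<open>
  An \<open>H_alg\<close>-module is a \<open>k\<close>-vector space through \<^const>\<open>H_const\<close>; it has dimension \<open>n\<close> if it has
  a basis \<open>b 0, \<dots>, b (n - 1)\<close>. Coefficient families are taken in \<^const>\<open>extensional\<close> so
  that they are determined by their values at the indices below \<open>n\<close>.
\<close>

definition has_k_dimension ::
    "('f::{finite, field} H_elem, 'm) module \<Rightarrow> nat \<Rightarrow> bool" where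
  "has_k_dimension M n \<longleftrightarrow>
    (\<exists>b. (\<forall>i<n. b i \<in> carrier M) \<and>
      (\<forall>m\<in>carrier M. \<exists>!c. c \<in> extensional {..<n} \<and>
         m = (\<Oplus>\<^bsub>M\<^esub>i\<in>{..<n}. H_const (c i) \<odot>\<^bsub>M\<^esub> b i)))"


section \<open>The module Delta and the element C\<close>

text \<open>The generator \<open>g\<^sub>i\<close> of \<open>E\<close> is \<open>H_group (\<xi> ^ (i - 1))\<close>.\<close>

definition Delta_ideal ::
    "'f::{finite, field} \<Rightarrow> nat \<Rightarrow> 'f alg_closure \<Rightarrow> 'f H_elem set" where
  "Delta_ideal \<xi> r \<alpha> =
    {u \<otimes>\<^bsub>H_alg\<^esub> (H_x \<ominus>\<^bsub>H_alg\<^esub> H_const \<alpha>) \<oplus>\<^bsub>H_alg\<^esub>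
       (\<Oplus>\<^bsub>H_alg\<^esub>i\<in>{1..r}. v i \<otimes>\<^bsub>H_alg\<^esub> (H_group (\<xi> ^ (i - 1)) \<ominus>\<^bsub>H_alg\<^esub> \<one>\<^bsub>H_alg\<^esub>)) |u v.
       u \<in> carrier H_alg \<and> (\<forall>i\<in>{1..r}. v i \<in> carrier H_alg)}"

definition Delta ::
    "'f::{finite, field} \<Rightarrow> nat \<Rightarrow> 'f alg_closure \<Rightarrow> ('f H_elem, 'f H_elem set) module" where
  "Delta \<xi> r \<alpha> = left_quotient H_alg (Delta_ideal \<xi> r \<alpha>)"

text \<open>
  The span of \<open>\<xi>, \<dots>, \<xi>\<^bsup>r-1\<^esup>\<close> over the prime field, which in positive characteristic is
  the range of \<^const>\<open>of_nat\<close>.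
\<close>

definition Xi :: "'f::{finite, field} \<Rightarrow> nat \<Rightarrow> 'f set" where
  "Xi \<xi> r = {(\<Sum>i\<in>{1..r-1}. c i * \<xi> ^ i) |c. \<forall>i. c i \<in> range (of_nat :: nat \<Rightarrow> 'f)}"

text \<open>
  The parameter \<open>\<zeta>s\<close> lists the elements of \<open>\<Xi>\<close> in the order in which the outer
  product is taken.
\<close>

definition C_elem :: "nat \<Rightarrow> 'f::{finite, field} list \<Rightarrow> 'f H_elem" where
  "C_elem p \<zeta>s = list_product H_alg (map (\<lambda>\<zeta>. list_product H_alg
     (map (\<lambda>a. H_y \<ominus>\<^bsub>H_alg\<^esub> H_const (to_ac (\<zeta> + of_nat a)) \<otimes>\<^bsub>H_alg\<^esub> H_x) [1..<p + 1])) \<zeta>s)"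

end

(*
  For nonzero alpha the algebra acts on V = k[t], where t plays the role of y x^(-1): the group
  element b acts by f(t) |-> f(t + b), x by the square root alpha^(-p) S^((p+1)/2) of
  S = alpha^2 + 2 (g_1 - 1), and y by t x. Since S^p = alpha^(2p), x is invertible, so
  multiplication by t lies in the image of the algebra. The map u |-> u.1 is surjective onto V and
  its kernel is the left ideal that defines Delta_alpha, because Delta_alpha is spanned by the
  images of the y^n and y^n.1 has degree n. Hence submodules of Delta_alpha are the ideals of k[t]
  that are invariant under the translations by F_q. Every proper one has a common zero mu,
  so it lies in the ideal of all polynomials vanishing on mu + F_q, and these ideals are exactly
  the maximal ones.

  Each factor prod_a (y - (zeta + a) x) commutes with x, y and g_1, hence acts on V as
  multiplication by a polynomial of degree p, so C acts as multiplication by a translation invariant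
  polynomial c of degree q. If mu is a root of c - beta, then c - beta vanishes on mu + F_q and,
  having degree q, it generates the maximal ideal above.

  A simple module on which x^p is a nonzero scalar alpha^p contains a common eigenvector of x (with
  eigenvalue alpha) and of the group (with eigenvalue 1), since x - alpha and all g - 1 are commuting
  nilpotent operators. It is therefore V modulo such an ideal, that is, the space of functions on a
  set of q points.
*)

theory Submission
  imports Defs
begin

text \<open>No basis of H is constructed. All arguments take place in the smash product, for the
  left ideals called \<open>admissible\<close>: the preimages of the left ideals of H that contain x
  - \<alpha> and all g - 1. Modulo any of them the powers of y span, and the images of these powers
  in k[t] have distinct degrees, so the kernel of u |-> u.1 lies in every admissible left ideal.
  This one fact serves the left ideal of Delta, the preimages of its submodules and the annihilator
  of an eigenvector in a simple module. The exponent n = (p+1)/2 does two jobs. Since 2n = p + 1,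
  the square of \<alpha>^(-p) S^n is S up to the scalar \<alpha>^(-2p) S^p = 1. Since 2n = 1 in k,
  differentiating S^n gives [x, t] = \<alpha>^(-p) g_1 S^(n-1), and multiplying by x on the right
  turns this into [x, y] = g_1. Oddness of p is also what makes the factors of C central in the
  image: moving y - \<zeta> x and g_1 through the product of the p linear factors involves p(p+1)/2
  and p(p-1)/2 equal correction terms, and p divides both numbers because p is odd.\<close>

section \<open>Identities in noncommutative rings\<close>

lemma commute_power:
  fixes a b :: "'a::monoid_mult"
  assumes "a * b = b * a"
  shows "a ^ n * b = b * a ^ n"
  by (induction n) (use assms in \<open>auto simp: mult.assoc\<close>, metis assms mult.assoc)

lemma binomial_commute:
  fixes a b :: "'a::ring_1"
  assumes "a * b = b * a"
  shows "(a + b) ^ n = (\<Sum>k\<le>n. of_nat (n choose k) * a ^ k * b ^ (n - k))"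
proof (induction n)
  case (Suc n)
  have ab: "b * a ^ k = a ^ k * b" for k
    using commute_power[OF assms] by simp
  have sh: "b * (of_nat c * a ^ k * b ^ j) = of_nat c * a ^ k * b ^ Suc j" for c k j
    by (metis (no_types, opaque_lifting) ab mult.assoc mult_of_nat_commute power_Suc)
  have sa: "a * (of_nat c * a ^ k * b ^ j) = of_nat c * a ^ Suc k * b ^ j" for c k j
    by (metis (no_types, opaque_lifting) mult.assoc mult_of_nat_commute power_Suc)
  have "(a + b) ^ Suc n = (\<Sum>k\<le>n. of_nat (n choose k) * a ^ Suc k * b ^ (n - k))
      + (\<Sum>k\<le>n. of_nat (n choose k) * a ^ k * b ^ Suc (n - k))"
    by (simp only: power_Suc[of "a + b"] Suc.IH distrib_right sum_distrib_left sa sh sum.distrib)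
  also have "(\<Sum>k\<le>n. of_nat (n choose k) * a ^ k * b ^ Suc (n - k))
     = b ^ Suc n + (\<Sum>k\<le>n. of_nat (n choose Suc k) * a ^ Suc k * b ^ (n - k))"
  proof -
    have "(\<Sum>k\<le>n. of_nat (n choose k) * a ^ k * b ^ Suc (n - k)) =
        (\<Sum>k\<le>Suc n. of_nat (n choose k) * a ^ k * b ^ (Suc n - k))"
      by (simp add: Suc_diff_le binomial_eq_0)
    also have "\<dots> = b ^ Suc n + (\<Sum>k\<le>n. of_nat (n choose Suc k) * a ^ Suc k * b ^ (n - k))"
      by (subst sum.atMost_Suc_shift) simp
    finally show ?thesis .
  qed
  also have "(\<Sum>k\<le>n. of_nat (n choose k) * a ^ Suc k * b ^ (n - k)) + (b ^ Suc n
      + (\<Sum>k\<le>n. of_nat (n choose Suc k) * a ^ Suc k * b ^ (n - k)))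
      = b ^ Suc n + (\<Sum>k\<le>n. of_nat (Suc n choose Suc k) * a ^ Suc k * b ^ (n - k))"
    by (simp add: sum.distrib distrib_right)
  also have "\<dots> = (\<Sum>k\<le>Suc n. of_nat (Suc n choose k) * a ^ k * b ^ (Suc n - k))"
    by (subst sum.atMost_Suc_shift) simp
  finally show ?case .
qed simp

text \<open>Needed in two rings: for the operators, to compute S^p, and for the smash product, to
  see that x - \<alpha> and g - 1 act nilpotently on a simple module.\<close>

lemma freshmans_dream_commute:
  fixes a b :: "'a::ring_1"
  assumes "a * b = b * a" "prime p" "of_nat p = (0 :: 'a)"
  shows "(a + b) ^ p = a ^ p + b ^ p"
proof -
  have p: "p > 0" using assms(2) prime_gt_0_nat by blast
  have "(a + b) ^ p = (\<Sum>k\<le>p. of_nat (p choose k) * a ^ k * b ^ (p - k))"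
    by (rule binomial_commute[OF assms(1)])
  also have "\<dots> = (\<Sum>k\<in>{0, p}. of_nat (p choose k) * a ^ k * b ^ (p - k))"
  proof (rule sum.mono_neutral_right)
    show "\<forall>k\<in>{..p} - {0, p}. of_nat (p choose k) * a ^ k * b ^ (p - k) = 0"
    proof
      fix k assume "k \<in> {..p} - {0, p}"
      then have "p dvd (p choose k)"
        by (intro dvd_choose_prime) (use assms(2) in auto)
      then obtain m where "p choose k = p * m" by blast
      then show "of_nat (p choose k) * a ^ k * b ^ (p - k) = 0"
        by (simp add: assms(3))
    qed
  qed auto
  also have "\<dots> = a ^ p + b ^ p"
    using p by (simp add: add.commute)
  finally show ?thesis .
qed

text \<open>
  Here \<open>A n\<close> models \<open>y - (\<zeta> + n) x\<close>. Moving \<open>x\<close> through \<open>A 1 \<cdots> A n\<close> collects \<open>n\<close> equal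
  correction terms, moving \<open>A 0\<close> through it collects \<open>1 + \<dots> + n\<close> of them.
\<close>
definition shifted_prod :: "(nat \<Rightarrow> 'a::monoid_mult) \<Rightarrow> nat \<Rightarrow> 'a" where
  "shifted_prod A n = prod_list (map A [1..<n + 1])"

lemma shifted_prod_0 [simp]: "shifted_prod A 0 = 1"
  and shifted_prod_Suc: "shifted_prod A (Suc n) = shifted_prod A n * A (Suc n)"
  by (simp_all add: shifted_prod_def)

lemma shifted_prod_shift:
  fixes A :: "nat \<Rightarrow> 'a::monoid_mult"
  assumes z_A: "\<And>n. z * A (Suc n) = A n * z"
  shows "z * shifted_prod A (Suc n) = A 0 * shifted_prod A n * z"
proof (induction n)
  case (Suc n)
  have "z * shifted_prod A (Suc (Suc n)) = (z * shifted_prod A (Suc n)) * A (Suc (Suc n))"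
    by (simp add: shifted_prod_Suc mult.assoc)
  also have "\<dots> = A 0 * (shifted_prod A n * A (Suc n)) * z"
    unfolding Suc.IH by (simp only: mult.assoc z_A)
  also have "\<dots> = A 0 * shifted_prod A (Suc n) * z"
    by (simp only: shifted_prod_Suc)
  finally show ?case .
qed (simp add: shifted_prod_Suc z_A)

text \<open>Passing the k-th factor leaves z in its place. Moving that z to the right end lowers the
  index of every later factor by one, which fills the gap at k, so all corrections are the same
  product \<open>shifted_prod A n * z\<close>.\<close>

lemma X_shifted_prod:
  fixes A :: "nat \<Rightarrow> 'a::ring_1"
  assumes x_A: "\<And>n. x * A n = A n * x + z"
    and z_A: "\<And>n. z * A (Suc n) = A n * z"
  shows "x * shifted_prod A (Suc n) =
    shifted_prod A (Suc n) * x + of_nat (Suc n) * (shifted_prod A n * z)"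
proof (induction n)
  case (Suc n)
  let ?Q = "shifted_prod A"
  have "x * ?Q (Suc (Suc n)) = (x * ?Q (Suc n)) * A (Suc (Suc n))"
    by (simp add: shifted_prod_Suc mult.assoc)
  also have "\<dots> = ?Q (Suc n) * (x * A (Suc (Suc n))) + of_nat (Suc n) * (?Q n * (z * A (Suc (Suc n))))"
    by (simp add: Suc.IH distrib_right mult.assoc del: of_nat_Suc)
  also have "\<dots> = ?Q (Suc (Suc n)) * x + of_nat (Suc (Suc n)) * (?Q (Suc n) * z)"
    by (simp add: x_A z_A shifted_prod_Suc mult.assoc algebra_simps)
  finally show ?case .
qed (simp add: shifted_prod_Suc x_A)

lemma A0_shifted_prod:
  fixes A :: "nat \<Rightarrow> 'a::ring_1"
  assumes z_A: "\<And>n. z * A (Suc n) = A n * z"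
    and A0_A: "\<And>n. A 0 * A n = A n * A 0 + of_nat n * z"
  shows "A 0 * shifted_prod A (Suc n) =
    shifted_prod A (Suc n) * A 0 + of_nat (Suc n * Suc (Suc n) div 2) * (shifted_prod A n * z)"
proof (induction n)
  case (Suc n)
  let ?t = "Suc n * Suc (Suc n) div 2" and ?Q = "shifted_prod A"
  have A: "?Q (Suc n) * (of_nat c * z) = of_nat c * (?Q (Suc n) * z)" for c
    by (metis mult.assoc mult_of_nat_commute)
  have "A 0 * ?Q (Suc (Suc n)) = (A 0 * ?Q (Suc n)) * A (Suc (Suc n))"
    by (simp add: shifted_prod_Suc mult.assoc)
  also have "\<dots> = ?Q (Suc n) * (A 0 * A (Suc (Suc n))) + of_nat ?t * (?Q n * (z * A (Suc (Suc n))))"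
    unfolding Suc.IH distrib_right by (simp only: mult.assoc)
  also have "?Q n * (z * A (Suc (Suc n))) = ?Q (Suc n) * z"
    by (simp only: shifted_prod_Suc[of A n] z_A mult.assoc)
  also have "?Q (Suc n) * (A 0 * A (Suc (Suc n))) =
      ?Q (Suc (Suc n)) * A 0 + of_nat (Suc (Suc n)) * (?Q (Suc n) * z)"
    by (simp only: A0_A distrib_left A shifted_prod_Suc[of A "Suc n"] mult.assoc)
  also have "\<dots> + of_nat ?t * (?Q (Suc n) * z) =
      ?Q (Suc (Suc n)) * A 0 + of_nat (Suc (Suc n) + ?t) * (?Q (Suc n) * z)"
    by (simp only: of_nat_add distrib_right add.assoc)
  also have "Suc (Suc n) + ?t = Suc (Suc n) * Suc (Suc (Suc n)) div 2"
    by simp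
  finally show ?case .
qed (use A0_A[of 1] in \<open>simp add: shifted_prod_Suc\<close>)

text \<open>The numbers of correction terms, p for x and p(p+1)/2 for \<open>A 0\<close>, vanish in
  characteristic p. For z the shorter product \<open>A 1\<close> ... \<open>A (p-1)\<close> is used:
  its count p(p-1)/2 also vanishes, so \<open>A 0\<close> may be moved from its front to its end,
  where it serves as the missing factor \<open>A p\<close>.\<close>

lemma shifted_prod_prime_commute:
  fixes A :: "nat \<Rightarrow> 'a::ring_1"
  assumes x_A: "\<And>n. x * A n = A n * x + z"
    and z_A: "\<And>n. z * A (Suc n) = A n * z"
    and A0_A: "\<And>n. A 0 * A n = A n * A 0 + of_nat n * z"
    and p: "prime p" "odd p" "of_nat p = (0 :: 'a)" and A_p: "A p = A 0"
  shows "x * shifted_prod A p = shifted_prod A p * x"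
    and "A 0 * shifted_prod A p = shifted_prod A p * A 0"
    and "z * shifted_prod A p = shifted_prod A p * z"
proof -
  let ?Q = "shifted_prod A"
  obtain m where m: "p = Suc (Suc m)"
    using le_Suc_ex[OF prime_ge_2_nat[OF p(1)]] by auto
  have "of_nat (Suc (Suc m)) = (0 :: 'a)" using p(3) by (simp only: m)
  then show "x * ?Q p = ?Q p * x"
    using X_shifted_prod[where A = A and x = x and z = z and n = "Suc m", OF x_A z_A] by (simp only: m mult_zero_left add_0_right)
  obtain d where d: "p = Suc (2 * d)" using p(2) by (auto elim!: oddE)
  have "p * Suc p div 2 = p * Suc d" by (simp add: d)
  then have "of_nat (p * Suc p div 2) = (0::'a)" by (simp only: of_nat_mult p(3)) simp
  then show "A 0 * ?Q p = ?Q p * A 0"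
    using A0_shifted_prod[where A = A and z = z and n = "Suc m", OF z_A A0_A] by (simp only: m) simp
  have "Suc m * Suc (Suc m) div 2 = p * d" using d m by simp
  then have "of_nat (Suc m * Suc (Suc m) div 2) = (0::'a)"
    by (simp only: of_nat_mult p(3)) simp
  then have "A 0 * ?Q (Suc m) = ?Q (Suc m) * A 0"
    using A0_shifted_prod[where A = A and z = z and n = m, OF z_A A0_A] by (simp only:) simp
  also have "\<dots> = ?Q p" using A_p by (simp add: m shifted_prod_Suc)
  finally show "z * ?Q p = ?Q p * z"
    using shifted_prod_shift[where A = A and z = z and n = "Suc m", OF z_A] by (simp add: m)
qed

section \<open>The ring of additive endomorphisms\<close>

text \<open>Only additivity is built into the type. Linearity over k is expressed as commutation
  with the operators \<open>mulp [:c:]\<close>.\<close>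

typedef (overloaded) ('v::ab_group_add) endo = "{f :: 'v \<Rightarrow> 'v. \<forall>x y. f (x + y) = f x + f y}"
  morphisms app Endo
  by (rule exI[of _ "\<lambda>x. x"]) simp

setup_lifting type_definition_endo

lemma app_Endo: "(\<And>x y. f (x + y) = f x + f y) \<Longrightarrow> app (Endo f) = f"
  by (simp add: Endo_inverse)

lemma app_add [simp]: "app e (x + y) = app e x + app e y"
  using app[of e] by simp

lemma app_zero [simp]: "app e 0 = 0"
  using app_add[of e 0 0] by simp

text \<open>The sort \<open>zero_neq_one\<close> guarantees a nonzero element, hence 0 \<noteq> 1
  among the endomorphisms.\<close>

instantiation endo :: ("{ab_group_add, zero_neq_one}") ring_1
begin
lift_definition zero_endo :: "'a endo" is "\<lambda>x. 0" by simp
lift_definition one_endo :: "'a endo" is "\<lambda>x. x" by simp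
lift_definition plus_endo :: "'a endo \<Rightarrow> 'a endo \<Rightarrow> 'a endo" is "\<lambda>f g x. f x + g x"
  by (simp add: algebra_simps)
lift_definition minus_endo :: "'a endo \<Rightarrow> 'a endo \<Rightarrow> 'a endo" is "\<lambda>f g x. f x - g x"
  by (simp add: algebra_simps)
lift_definition uminus_endo :: "'a endo \<Rightarrow> 'a endo" is "\<lambda>f x. - f x"
  by (simp add: algebra_simps)
lift_definition times_endo :: "'a endo \<Rightarrow> 'a endo \<Rightarrow> 'a endo" is "\<lambda>f g x. f (g x)"
  by simp
instance
proof
  show "(0 :: 'a endo) \<noteq> 1"
    by transfer (metis zero_neq_one)
  show "a * (b + c) = a * b + a * c" for a b c :: "'a endo"
    by transfer simp
qed (transfer; simp add: algebra_simps fun_eq_iff)+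
end

lemma app_ring [simp]:
  fixes e f :: "'v :: {ab_group_add, zero_neq_one} endo"
  shows "app 0 v = (0 :: 'v)" "app 1 v = v" "app (e + f) v = app e v + app f v"
    "app (e - f) v = app e v - app f v" "app (- e) v = - app e v" "app (e * f) v = app e (app f v)"
  by (transfer; simp)+

lemma endo_eqI: "(\<And>v. app e v = app f v) \<Longrightarrow> e = f"
  by (simp add: app_inject[symmetric] fun_eq_iff)

section \<open>Evaluation of noncommutative polynomials\<close>

lemma poly_mapping_single_induct [case_names single add]:
  fixes f :: "'a \<Rightarrow>\<^sub>0 'b::comm_monoid_add"
  assumes single: "\<And>w c. P (Poly_Mapping.single w c)"
    and add: "\<And>f g. P f \<Longrightarrow> P g \<Longrightarrow> P (f + g)"
  shows "P f"
proof (induction f rule: update_induct)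
  case const
  show ?case using single[of undefined 0] by simp
next
  case (update f w c)
  have "Poly_Mapping.update w c f = f + Poly_Mapping.single w c"
    using update.hyps(1)
    by (intro poly_mapping_eqI) (auto simp: lookup_update lookup_add lookup_single in_keys_iff when_def)
  then show ?case using add[OF update.IH single] by simp
qed

lemma plus_Word: "Word us + Word vs = Word (us @ vs)"
  by (simp add: plus_word_def)

lemma letters_plus: "letters (u + v) = letters u @ letters v"
  by (simp add: plus_word_def)

lemma letters_zero [simp]: "letters 0 = []"
  by (simp add: zero_word_def)

text \<open>The formula has the shape of \<open>act\<close>, so that both the action of E on the
  free algebra and the representation by operators on k[t] become instances.\<close>

definition free_eval ::
    "('c::comm_ring_1 \<Rightarrow> 'r::ring_1) \<Rightarrow> (letter \<Rightarrow> 'r) \<Rightarrow> (word \<Rightarrow>\<^sub>0 'c) \<Rightarrow> 'r" where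
  "free_eval \<kappa> l f =
    (\<Sum>w\<in>Poly_Mapping.keys f. \<kappa> (Poly_Mapping.lookup f w) * prod_list (map l (letters w)))"

locale free_evaluation =
  fixes \<kappa> :: "'c::comm_ring_1 \<Rightarrow> 'r::ring_1" and l :: "letter \<Rightarrow> 'r"
  assumes \<kappa>_add: "\<kappa> (a + b) = \<kappa> a + \<kappa> b"
    and \<kappa>_mult: "\<kappa> (a * b) = \<kappa> a * \<kappa> b"
    and \<kappa>_1 [simp]: "\<kappa> 1 = 1"
    and \<kappa>_l: "l i * \<kappa> a = \<kappa> a * l i"
begin

abbreviation ev :: "(word \<Rightarrow>\<^sub>0 'c) \<Rightarrow> 'r" where "ev \<equiv> free_eval \<kappa> l"

lemma \<kappa>_0 [simp]: "\<kappa> 0 = 0"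
  using \<kappa>_add[of 0 0] by simp

lemma ev_superset:
  assumes "finite A" "Poly_Mapping.keys f \<subseteq> A"
  shows "ev f = (\<Sum>w\<in>A. \<kappa> (Poly_Mapping.lookup f w) * prod_list (map l (letters w)))"
  unfolding free_eval_def
  by (rule sum.mono_neutral_left) (use assms in \<open>auto simp: in_keys_iff\<close>)

lemma ev_add: "ev (f + g) = ev f + ev g"
proof -
  let ?A = "Poly_Mapping.keys f \<union> Poly_Mapping.keys g"
  have "ev (f + g) = (\<Sum>w\<in>?A. \<kappa> (Poly_Mapping.lookup (f + g) w) * prod_list (map l (letters w)))"
    by (rule ev_superset) (auto simp: in_keys_iff lookup_add)
  also have "\<dots> = ev f + ev g"
    by (simp add: ev_superset[of ?A f] ev_superset[of ?A g] lookup_add \<kappa>_add distrib_right sum.distrib)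
  finally show ?thesis .
qed

lemma ev_0 [simp]: "ev 0 = 0"
  by (simp add: free_eval_def)

lemma ev_sum: "ev (\<Sum>i\<in>I. f i) = (\<Sum>i\<in>I. ev (f i))"
  by (induction I rule: infinite_finite_induct) (auto simp: ev_add)

lemma ev_single: "ev (Poly_Mapping.single w c) = \<kappa> c * prod_list (map l (letters w))"
  by (subst ev_superset[of "{w}"]) auto

lemma \<kappa>_word: "prod_list (map l ls) * \<kappa> a = \<kappa> a * prod_list (map l ls)"
proof (induction ls)
  case (Cons i ls)
  have "prod_list (map l (i # ls)) * \<kappa> a = l i * (prod_list (map l ls) * \<kappa> a)"
    by (simp add: mult.assoc)
  also have "\<dots> = (l i * \<kappa> a) * prod_list (map l ls)"
    unfolding Cons by (simp only: mult.assoc)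
  also have "\<dots> = \<kappa> a * prod_list (map l (i # ls))"
    unfolding \<kappa>_l by (simp add: mult.assoc)
  finally show ?case .
qed simp

lemma ev_mult: "ev (f * g) = ev f * ev g"
proof (induction f rule: poly_mapping_single_induct)
  case (single u c)
  show ?case
  proof (induction g rule: poly_mapping_single_induct)
    case (single v d)
    let ?u = "prod_list (map l (letters u))" and ?v = "prod_list (map l (letters v))"
    have "\<kappa> c * \<kappa> d * (?u * ?v) = \<kappa> c * (\<kappa> d * ?u) * ?v"
      by (simp only: mult.assoc)
    also have "\<dots> = \<kappa> c * ?u * (\<kappa> d * ?v)"
      unfolding \<kappa>_word[of "letters u" d, symmetric] by (simp only: mult.assoc)
    finally show ?case
      by (simp only: mult_single ev_single letters_plus \<kappa>_mult map_append prod_list.append)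
  qed (simp add: ev_add distrib_left)
qed (simp add: ev_add distrib_right)

lemma ev_1 [simp]: "ev 1 = 1"
  using ev_single[of 0 1] by simp

lemma ev_const: "ev (Poly_Mapping.single 0 c) = \<kappa> c"
  by (simp add: ev_single)

lemma ev_letter: "ev (Poly_Mapping.single (Word [i]) 1) = l i"
  by (simp add: ev_single)

end

lemma free_const_add: "free_const (a + b) = free_const a + free_const b"
  by (simp add: free_const_def single_add)

lemma free_const_mult: "free_const (a * b) = free_const a * free_const b"
  by (simp add: free_const_def mult_single)

lemma free_const_1: "free_const 1 = 1"
  by (simp add: free_const_def)

lemma free_const_central: "f * free_const c = free_const c * f"
proof (induction f rule: poly_mapping_single_induct)
  case (single w d)
  then show ?case by (simp add: free_const_def mult_single mult.commute)
qed (simp add: distrib_left distrib_right)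

interpretation act: free_evaluation free_const "act_letter a"
  rewrites "free_eval free_const (act_letter a) = act a" for a
proof -
  show "free_evaluation free_const (act_letter a)"
    by unfold_locales (rule free_const_add free_const_mult free_const_1 free_const_central)+
  show "free_eval free_const (act_letter a) = act a"
    by (simp add: fun_eq_iff act_def free_eval_def)
qed

lemma act_const [simp]: "act a (free_const c) = free_const c"
  by (metis act.ev_const free_const_def)

lemma act_x [simp]: "act a free_x = free_x"
  unfolding free_x_def act.ev_letter by (simp add: free_x_def)

lemma act_y [simp]: "act a free_y = free_y + free_const (to_ac a) * free_x"
  unfolding free_y_def act.ev_letter by (simp add: free_y_def)

lemma free_algebra_induct [case_names const const_mult x y add]:
  assumes const: "\<And>c. P (free_const c)"
    and const_mult: "\<And>c f. P f \<Longrightarrow> P (free_const c * f)"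
    and x: "\<And>f. P f \<Longrightarrow> P (free_x * f)"
    and y: "\<And>f. P f \<Longrightarrow> P (free_y * f)"
    and add: "\<And>f g. P f \<Longrightarrow> P g \<Longrightarrow> P (f + g)"
  shows "P f"
proof (induction f rule: poly_mapping_single_induct)
  case (single w c)
  have "P (Poly_Mapping.single (Word ls) 1)" for ls
  proof (induction ls)
    case Nil
    show ?case using const[of 1] by (simp add: free_const_def zero_word_def)
  next
    case (Cons i ls)
    have "Poly_Mapping.single (Word (i # ls)) 1 =
        Poly_Mapping.single (Word [i]) (1 :: 'a alg_closure) * Poly_Mapping.single (Word ls) 1"
      by (simp only: mult_single plus_Word append_Cons append_Nil mult_1)
    then show ?case
      using x[OF Cons] y[OF Cons] by (cases i) (simp_all add: free_x_def free_y_def)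
  qed
  from const_mult[OF this[of "letters w"], of c] show ?case
    by (simp add: free_const_def mult_single)
qed (rule add)

lemma free_const_0: "free_const 0 = 0"
  by (simp add: free_const_def)

lemma act_0 [simp]: "act 0 f = f"
  by (induction f rule: free_algebra_induct)
    (simp_all only: act.ev_mult act.ev_add act_const act_x act_y to_ac_0 free_const_0
      mult_zero_left add_0_right)

lemma act_act: "act a (act b f) = act (a + b) f"
proof (induction f rule: free_algebra_induct)
  case (y f)
  have "act a (act b free_y) = act (a + b) free_y"
    by (simp only: act_y act.ev_add act.ev_mult act_const act_x to_ac_add free_const_add
      distrib_right add.assoc)
  then show ?case by (simp only: act.ev_mult y)
qed (simp_all only: act.ev_mult act.ev_add act_const act_x)

section \<open>The smash product as a ring\<close>

text \<open>A copy of the functions underlying \<open>smash_product\<close> that can be made an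
  instance of \<open>ring_1\<close>. Computations are done with class operations and carried over to
  the record by \<open>smash_product_simps\<close>.\<close>

typedef (overloaded) 'f smash = "UNIV :: ('f::{finite, field} \<Rightarrow> 'f free_algebra) set"
  morphisms coeffs Smash by simp

lemma coeffs_Smash [simp]: "coeffs (Smash F) = F"
  by (simp add: Smash_inverse)

lemma smash_eqI: "(\<And>c. coeffs F c = coeffs G c) \<Longrightarrow> F = G"
  by (simp add: coeffs_inject[symmetric] fun_eq_iff)

instantiation smash :: ("{finite, field}") ring_1
begin
definition "0 = Smash (\<lambda>c. 0)"
definition "1 = Smash (\<lambda>c. if c = 0 then 1 else 0)"
definition "F + G = Smash (\<lambda>c. coeffs F c + coeffs G c)"
definition "F - G = Smash (\<lambda>c. coeffs F c - coeffs G c)"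
definition "- F = Smash (\<lambda>c. - coeffs F c)"
definition "F * G = Smash (\<lambda>c. \<Sum>a\<in>UNIV. coeffs F a * act a (coeffs G (c - a)))"
instance
proof
  fix F G K :: "'a smash"
  show "F * G * K = F * (G * K)"
  proof (rule smash_eqI)
    fix c
    have "coeffs (F * G * K) c =
        (\<Sum>b\<in>UNIV. \<Sum>a\<in>UNIV. coeffs F a * act a (coeffs G (b - a)) * act b (coeffs K (c - b)))"
      by (simp add: times_smash_def sum_distrib_right)
    also have "\<dots> = (\<Sum>a\<in>UNIV. \<Sum>b\<in>UNIV. coeffs F a * act a (coeffs G (b - a)) * act b (coeffs K (c - b)))"
      by (rule sum.swap)
    also have "\<dots> = (\<Sum>a\<in>UNIV. \<Sum>d\<in>UNIV. coeffs F a * act a (coeffs G d) * act (a + d) (coeffs K (c - a - d)))"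
    proof (rule sum.cong)
      show "(\<Sum>b\<in>UNIV. coeffs F a * act a (coeffs G (b - a)) * act b (coeffs K (c - b))) =
        (\<Sum>d\<in>UNIV. coeffs F a * act a (coeffs G d) * act (a + d) (coeffs K (c - a - d)))" for a
        by (rule sum.reindex_bij_witness[of _ "\<lambda>d. a + d" "\<lambda>b. b - a"]) auto
    qed simp
    also have "\<dots> = coeffs (F * (G * K)) c"
      by (simp add: times_smash_def act.ev_sum act.ev_mult act_act sum_distrib_left mult.assoc)
    finally show "coeffs (F * G * K) c = coeffs (F * (G * K)) c" .
  qed
  show "1 * F = F"
    by (rule smash_eqI) (simp add: times_smash_def one_smash_def if_distrib[of "\<lambda>x. x * _"] cong: if_cong)
  have "coeffs F a * act a (if c = a then 1 else 0) = (if a = c then coeffs F a else 0)" for a c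
    by simp
  then show "F * 1 = F"
    by (intro smash_eqI) (simp add: times_smash_def one_smash_def)
  show "(F + G) * K = F * K + G * K" "F * (G + K) = F * G + F * K"
    by (simp_all add: times_smash_def plus_smash_def act.ev_add algebra_simps sum.distrib)
  show "(0 :: 'a smash) \<noteq> 1"
    by (simp add: zero_smash_def one_smash_def Smash_inject fun_eq_iff exI[of _ 0])
qed (simp_all add: plus_smash_def zero_smash_def minus_smash_def uminus_smash_def coeffs_inverse
      ac_simps)
end

lemma coeffs_add [simp]: "coeffs (F + G) c = coeffs F c + coeffs G c"
  and coeffs_0 [simp]: "coeffs 0 c = 0"
  by (simp_all add: plus_smash_def zero_smash_def)

lemma coeffs_sum: "coeffs (\<Sum>i\<in>I. F i) c = (\<Sum>i\<in>I. coeffs (F i) c)"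
  by (induction I rule: infinite_finite_induct) auto

definition sfree :: "'f::{finite, field} free_algebra \<Rightarrow> 'f smash" where
  "sfree f = Smash (smash_of_free f)"

definition sgroup :: "'f::{finite, field} \<Rightarrow> 'f smash" where
  "sgroup a = Smash (smash_of_group a)"

abbreviation sconst :: "'f alg_closure \<Rightarrow> 'f::{finite, field} smash" where
  "sconst c \<equiv> sfree (free_const c)"

abbreviation sx :: "'f::{finite, field} smash" where "sx \<equiv> sfree free_x"
abbreviation sy :: "'f::{finite, field} smash" where "sy \<equiv> sfree free_y"

lemma coeffs_sfree_mult: "coeffs (sfree f * F) c = f * coeffs F c"
  by (simp add: times_smash_def sfree_def smash_of_free_def if_distrib[of "\<lambda>x. x * _"] cong: if_cong)

lemma coeffs_mult_sgroup: "coeffs (F * sgroup a) c = coeffs F (c - a)"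
proof -
  have "coeffs F b * act b (if c - b = a then 1 else 0) = (if b = c - a then coeffs F b else 0)" for b
    by (auto simp: algebra_simps)
  then show ?thesis
    by (simp add: times_smash_def sgroup_def smash_of_group_def)
qed

lemma coeffs_sfree: "coeffs (sfree f) c = (if c = 0 then f else 0)"
  by (simp add: sfree_def smash_of_free_def)

lemma coeffs_sgroup: "coeffs (sgroup a) c = (if c = a then 1 else 0)"
  by (simp add: sgroup_def smash_of_group_def)

lemma coeffs_1: "coeffs 1 c = (if c = 0 then 1 else 0)"
  by (simp add: one_smash_def)

lemma sfree_add: "sfree (f + g) = sfree f + sfree g"
  by (rule smash_eqI) (simp add: coeffs_sfree)

lemma sfree_mult: "sfree (f * g) = sfree f * sfree g"
  by (rule smash_eqI) (simp add: coeffs_sfree coeffs_sfree_mult)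

lemma sfree_1 [simp]: "sfree 1 = 1"
  by (rule smash_eqI) (simp add: coeffs_sfree coeffs_1)

lemma sfree_0 [simp]: "sfree 0 = 0"
  by (rule smash_eqI) (simp add: coeffs_sfree)

lemma sfree_minus: "sfree (- f) = - sfree f"
  using sfree_add[of f "- f"] by (simp add: eq_neg_iff_add_eq_0 add.commute)

lemma sfree_diff: "sfree (f - g) = sfree f - sfree g"
  using sfree_add[of f "- g"] by (simp add: sfree_minus)

lemma sgroup_0 [simp]: "sgroup 0 = 1"
  by (rule smash_eqI) (simp add: coeffs_sgroup coeffs_1)

lemma sgroup_add: "sgroup (a + b) = sgroup a * sgroup b"
  by (rule smash_eqI) (auto simp: coeffs_sgroup coeffs_mult_sgroup algebra_simps)

lemma sgroup_sfree: "sgroup a * sfree f = sfree (act a f) * sgroup a"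
proof (rule smash_eqI)
  fix c
  have "coeffs (sgroup a * sfree f) c =
      (\<Sum>b\<in>UNIV. if b = a then act a (coeffs (sfree f) (c - a)) else 0)"
    unfolding times_smash_def coeffs_Smash by (rule sum.cong) (simp_all add: coeffs_sgroup)
  then show "coeffs (sgroup a * sfree f) c = coeffs (sfree (act a f) * sgroup a) c"
    by (simp add: coeffs_sfree_mult coeffs_sgroup coeffs_sfree)
qed

lemma smash_expand: "F = (\<Sum>a\<in>UNIV. sfree (coeffs F a) * sgroup a)"
proof (rule smash_eqI)
  fix c
  have "(\<Sum>a\<in>UNIV. coeffs F a * (if c = a then 1 else 0)) = coeffs F c"
    by (simp add: if_distrib[of "\<lambda>x. _ * x"] cong: if_cong)
  then show "coeffs F c = coeffs (\<Sum>a\<in>UNIV. sfree (coeffs F a) * sgroup a) c"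
    by (simp add: coeffs_sum coeffs_sfree_mult coeffs_sgroup)
qed

lemma sconst_add: "sconst (a + b) = sconst a + sconst b"
  and sconst_mult: "sconst (a * b) = sconst a * sconst b"
  and sconst_1 [simp]: "sconst 1 = 1"
  by (simp_all add: free_const_add free_const_mult free_const_1 sfree_add sfree_mult)

lemma sconst_0 [simp]: "sconst 0 = 0"
  by (simp add: free_const_0)

lemma sconst_power: "sconst (a ^ n) = sconst a ^ n"
  by (induction n) (simp_all add: sconst_mult)

lemma sconst_central: "F * sconst c = sconst c * F"
proof -
  have "sfree f * sgroup a * sconst c = sconst c * (sfree f * sgroup a)" for f a
  proof -
    have "sfree f * sgroup a * sconst c = sfree (f * free_const c) * sgroup a"
      by (simp only: mult.assoc sgroup_sfree act_const sfree_mult)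
    then show ?thesis
      by (simp only: free_const_central sfree_mult mult.assoc)
  qed
  then show ?thesis
    by (subst (1 2) smash_expand[of F]) (simp add: sum_distrib_left sum_distrib_right)
qed

lemma sgroup_sx: "sgroup a * sx = sx * sgroup a"
  by (simp add: sgroup_sfree)

lemma sgroup_sy: "sgroup a * sy = (sy + sconst (to_ac a) * sx) * sgroup a"
  by (simp add: sgroup_sfree sfree_add sfree_mult)

text \<open>The generators act from the left, which suits the two uses: showing that an increasing
  family of subsets exhausts the algebra, and that a set of polynomials is invariant under all
  operators.\<close>

lemma smash_induct [case_names one const x y group add]:
  assumes one: "P 1"
    and const: "\<And>c F. P F \<Longrightarrow> P (sconst c * F)"
    and x: "\<And>F. P F \<Longrightarrow> P (sx * F)"
    and y: "\<And>F. P F \<Longrightarrow> P (sy * F)"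
    and group: "\<And>a F. P F \<Longrightarrow> P (sgroup a * F)"
    and add: "\<And>F G. P F \<Longrightarrow> P G \<Longrightarrow> P (F + G)"
  shows "P F"
proof -
  have free: "P (sfree f * G)" if "P G" for f G
    by (induction f rule: free_algebra_induct)
      (simp_all add: sfree_add sfree_mult mult.assoc distrib_right that const x y add)
  have "P (\<Sum>a\<in>A. sfree (coeffs F a) * sgroup a)" for A
  proof (induction A rule: infinite_finite_induct)
    case (insert a A)
    then show ?case
      using add free[OF group[OF one]] by simp
  qed (use free[OF one, of 0] in simp_all)
  then show ?thesis by (subst smash_expand)
qed

definition smash_eval ::
    "('f::{finite, field} alg_closure \<Rightarrow> 'r::ring_1) \<Rightarrow> (letter \<Rightarrow> 'r) \<Rightarrow> ('f \<Rightarrow> 'r) \<Rightarrow> 'f smash \<Rightarrow> 'r" where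
  "smash_eval \<kappa> l g F = (\<Sum>a\<in>UNIV. free_eval \<kappa> l (coeffs F a) * g a)"

text \<open>This is the universal property of the smash product. Covariance of the group with the
  free algebra is demanded on the two letters; \<open>g_ev\<close> extends it to all noncommutative
  polynomials.\<close>

locale smash_evaluation = free_evaluation \<kappa> l
  for \<kappa> :: "'f::{finite, field} alg_closure \<Rightarrow> 'r::ring_1" and l +
  fixes g :: "'f \<Rightarrow> 'r"
  assumes g_0 [simp]: "g 0 = 1"
    and g_add: "g (a + b) = g a * g b"
    and g_\<kappa>: "g a * \<kappa> c = \<kappa> c * g a"
    and g_x: "g a * l LX = l LX * g a"
    and g_y: "g a * l LY = (l LY + \<kappa> (to_ac a) * l LX) * g a"
begin

abbreviation sev :: "'f smash \<Rightarrow> 'r" where "sev \<equiv> smash_eval \<kappa> l g"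

lemma ev_fconst: "ev (free_const c) = \<kappa> c"
  by (simp add: free_const_def ev_const)

lemma ev_x: "ev free_x = l LX" and ev_y: "ev free_y = l LY"
  by (simp_all add: free_x_def free_y_def ev_letter)

lemma g_ev: "g a * ev f = ev (act a f) * g a"
proof (induction f rule: free_algebra_induct)
  case (const c)
  then show ?case by (simp only: act_const ev_fconst g_\<kappa>)
next
  case (const_mult c f)
  have "g a * ev (free_const c * f) = \<kappa> c * (g a * ev f)"
    by (simp only: ev_mult ev_fconst mult.assoc[symmetric] g_\<kappa>)
  then show ?case
    by (simp only: const_mult act.ev_mult act_const ev_mult ev_fconst mult.assoc)
next
  case (x f)
  have "g a * ev (free_x * f) = l LX * (g a * ev f)"
    by (simp only: ev_mult ev_x mult.assoc[symmetric] g_x)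
  then show ?case
    by (simp only: x act.ev_mult act_x ev_mult ev_x mult.assoc)
next
  case (y f)
  have "g a * ev (free_y * f) = (l LY + \<kappa> (to_ac a) * l LX) * (g a * ev f)"
    by (simp only: ev_mult ev_y mult.assoc[symmetric] g_y)
  then show ?case
    by (simp only: y act.ev_mult act_y ev_add ev_mult ev_fconst ev_x ev_y mult.assoc)
next
  case (add f1 f2)
  then show ?case by (simp only: act.ev_add ev_add distrib_left distrib_right)
qed

lemma sev_add: "sev (F + G) = sev F + sev G"
  by (simp add: smash_eval_def ev_add algebra_simps sum.distrib)

lemma sev_0 [simp]: "sev 0 = 0"
  by (simp add: smash_eval_def)

lemma sev_minus: "sev (- F) = - sev F"
  using sev_add[of F "- F"] by (simp add: eq_neg_iff_add_eq_0 add.commute)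

lemma sev_diff: "sev (F - G) = sev F - sev G"
  using sev_add[of F "- G"] by (simp add: sev_minus)

lemma sev_sfree: "sev (sfree f) = ev f"
proof -
  have "sev (sfree f) = (\<Sum>a\<in>(UNIV :: 'f set). if a = 0 then ev f else 0)"
    unfolding smash_eval_def by (rule sum.cong) (auto simp: coeffs_sfree)
  then show ?thesis by simp
qed

lemma sev_sgroup: "sev (sgroup a) = g a"
proof -
  have "sev (sgroup a) = (\<Sum>b\<in>UNIV. if b = a then g a else 0)"
    unfolding smash_eval_def by (rule sum.cong) (auto simp: coeffs_sgroup)
  then show ?thesis by simp
qed

lemma sev_1 [simp]: "sev 1 = 1"
  using sev_sfree[of 1] by simp

lemma sev_sconst: "sev (sconst c) = \<kappa> c" and sev_sx: "sev sx = l LX" and sev_sy: "sev sy = l LY"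
  by (simp_all add: sev_sfree ev_fconst ev_x ev_y)

lemma sev_mult: "sev (F * G) = sev F * sev G"
proof -
  have "sev (F * G) = (\<Sum>c\<in>UNIV. \<Sum>a\<in>UNIV. ev (coeffs F a) * ev (act a (coeffs G (c - a))) * g c)"
    by (simp add: smash_eval_def times_smash_def ev_sum ev_mult sum_distrib_right)
  also have "\<dots> = (\<Sum>a\<in>UNIV. \<Sum>c\<in>UNIV. ev (coeffs F a) * ev (act a (coeffs G (c - a))) * g c)"
    by (rule sum.swap)
  also have "\<dots> = (\<Sum>a\<in>UNIV. \<Sum>d\<in>UNIV. ev (coeffs F a) * ev (act a (coeffs G d)) * g (a + d))"
  proof (rule sum.cong)
    show "(\<Sum>c\<in>UNIV. ev (coeffs F a) * ev (act a (coeffs G (c - a))) * g c) =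
      (\<Sum>d\<in>UNIV. ev (coeffs F a) * ev (act a (coeffs G d)) * g (a + d))" for a
      by (rule sum.reindex_bij_witness[of _ "\<lambda>d. a + d" "\<lambda>b. b - a"]) auto
  qed simp
  also have "\<dots> = (\<Sum>a\<in>UNIV. \<Sum>d\<in>UNIV. (ev (coeffs F a) * g a) * (ev (coeffs G d) * g d))"
  proof (intro sum.cong refl)
    fix a d
    have "ev (act a (coeffs G d)) * g (a + d) = (g a * ev (coeffs G d)) * g d"
      by (simp only: g_add g_ev mult.assoc)
    then show "ev (coeffs F a) * ev (act a (coeffs G d)) * g (a + d) =
      (ev (coeffs F a) * g a) * (ev (coeffs G d) * g d)"
      by (simp only: mult.assoc)
  qed
  also have "\<dots> = sev F * sev G"
    by (simp add: smash_eval_def sum_product)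
  finally show ?thesis .
qed

lemma sev_power: "sev (F ^ n) = sev F ^ n"
  by (induction n) (simp_all add: sev_mult)

end

section \<open>Operators on polynomials\<close>

text \<open>The derivative of a power along t. It is applied to s = \<open>opS\<close>, whose
  commutator with t is 2 g_1.\<close>

lemma power_commutator:
  fixes s t :: "'a::ring_1"
  assumes "s * t = t * s + w" "s * w = w * s"
  shows "s ^ Suc n * t = t * s ^ Suc n + of_nat (Suc n) * (w * s ^ n)"
proof (induction n)
  case (Suc n)
  have sn: "s * (of_nat k * (w * s ^ n)) = of_nat k * (w * s ^ Suc n)" for k
  proof -
    have "s * (of_nat k * (w * s ^ n)) = of_nat k * ((s * w) * s ^ n)"
      by (simp only: mult.assoc[symmetric] mult_of_nat_commute[of k s])
    then show ?thesis by (simp only: assms(2) mult.assoc power_Suc)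
  qed
  have "s ^ Suc (Suc n) * t = s * (s ^ Suc n * t)"
    by (simp only: power_Suc[of s "Suc n"] mult.assoc)
  also have "\<dots> = (s * t) * s ^ Suc n + of_nat (Suc n) * (w * s ^ Suc n)"
    unfolding Suc.IH distrib_left sn by (simp only: mult.assoc)
  also have "\<dots> = t * s ^ Suc (Suc n) + (w * s ^ Suc n + of_nat (Suc n) * (w * s ^ Suc n))"
    unfolding assms(1) by (simp only: distrib_right mult.assoc power_Suc add.assoc)
  also have "w * s ^ Suc n + of_nat (Suc n) * (w * s ^ Suc n) = of_nat (Suc (Suc n)) * (w * s ^ Suc n)"
    unfolding of_nat_Suc[of "Suc n"] distrib_right mult_1 ..
  finally show ?case .
qed (simp add: assms(1))

definition mulp :: "'a::field poly \<Rightarrow> 'a poly endo" where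
  "mulp h = Endo (\<lambda>f. h * f)"

definition translate :: "'a::field \<Rightarrow> 'a poly endo" where
  "translate b = Endo (\<lambda>f. pcompose f [:b, 1:])"

lemma app_mulp [simp]: "app (mulp h) f = h * f"
  by (simp add: mulp_def app_Endo distrib_left)

lemma app_translate [simp]: "app (translate b) f = pcompose f [:b, 1:]"
  by (simp add: translate_def app_Endo pcompose_add)

lemma mulp_add: "mulp (h + k) = mulp h + mulp k"
  and mulp_diff: "mulp (h - k) = mulp h - mulp k"
  and mulp_mult: "mulp (h * k) = mulp h * mulp k"
  and mulp_1 [simp]: "mulp 1 = 1" and mulp_0 [simp]: "mulp 0 = 0"
  by (rule endo_eqI; simp add: algebra_simps)+

lemma mulp_commute: "mulp h * mulp k = mulp k * mulp h"
  by (simp only: mulp_mult[symmetric] mult.commute)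

lemma mulp_const_mult: "mulp [:c * d:] = mulp [:c:] * mulp [:d:]"
  and mulp_const_add: "mulp [:c + d:] = mulp [:c:] + mulp [:d:]"
  and mulp_const_1: "mulp [:1:] = 1"
  by (rule endo_eqI; simp add: smult_add_left mult.commute)+

lemma mulp_const_power: "mulp [:c ^ n:] = mulp [:c:] ^ n"
  by (induction n) (simp_all add: mulp_const_mult mulp_const_1)

lemma mulp_of_nat: "mulp [:of_nat n:] = of_nat n"
  by (induction n) (simp_all add: mulp_0 mulp_const_add mulp_const_1)

lemma translate_0 [simp]: "translate 0 = 1"
  by (rule endo_eqI) simp

lemma translate_add: "translate (a + b) = translate a * translate b"
  by (rule endo_eqI) (simp add: pcompose_assoc[symmetric] pcompose_pCons algebra_simps)

lemma translate_commute: "translate a * translate b = translate b * translate a"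
  by (simp only: translate_add[symmetric] add.commute)

lemma translate_mulp: "translate a * mulp h = mulp (pcompose h [:a, 1:]) * translate a"
  by (rule endo_eqI) (simp add: pcompose_mult)

lemma translate_const: "translate a * mulp [:c:] = mulp [:c:] * translate a"
  by (simp add: translate_mulp)

text \<open>As a module over itself k[t] is generated by 1, so an operator that commutes with the
  scalars and with t is determined by its value at 1.\<close>

lemma endo_eq_mulp:
  fixes e :: "'a::field poly endo"
  assumes const: "\<And>c. e * mulp [:c:] = mulp [:c:] * e"
    and var: "e * mulp [:0, 1:] = mulp [:0, 1:] * e"
  shows "e = mulp (app e 1)"
proof (rule endo_eqI)
  fix f
  have *: "app e (smult c g) = smult c (app e g)" "app e ([:0, 1:] * g) = [:0, 1:] * app e g" for c g
    using arg_cong[OF const, of "\<lambda>x. app x g"] arg_cong[OF var, of "\<lambda>x. app x g"] by simp_all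
  show "app e f = app (mulp (app e 1)) f"
  proof (induction f)
    case (pCons a f)
    have eq: "pCons a f = smult a 1 + [:0, 1:] * f" by simp
    show ?case
      unfolding eq app_add * app_mulp distrib_left using pCons.IH
      by (simp del: mult_pCons_left)
  qed simp
qed

text \<open>Quantifying over all bounds n of the degree, instead of taking the degree itself, treats
  the zero polynomial and sums with cancelling leading terms uniformly.\<close>

definition triangular :: "'a::field \<Rightarrow> 'a poly endo \<Rightarrow> bool" where
  "triangular c e \<longleftrightarrow>
     (\<forall>f n. degree f \<le> n \<longrightarrow> degree (app e f) \<le> n \<and> coeff (app e f) n = c * coeff f n)"

lemma triangular_mult: "triangular c d \<Longrightarrow> triangular c' d' \<Longrightarrow> triangular (c * c') (d * d')"
  by (simp add: triangular_def mult.assoc)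

lemma triangular_add: "triangular c d \<Longrightarrow> triangular c' d' \<Longrightarrow> triangular (c + c') (d + d')"
  by (simp add: triangular_def algebra_simps degree_add_le)

lemma triangular_const: "triangular c (mulp [:c:])"
  by (auto simp: triangular_def intro: order_trans[OF degree_smult_le])

lemma triangular_power: "triangular c d \<Longrightarrow> triangular (c ^ n) (d ^ n)"
  by (induction n) (simp_all add: triangular_mult, simp add: triangular_def)

lemma triangular_trans: "triangular 1 (translate b)"
  unfolding triangular_def
proof (intro allI impI)
  fix f :: "'a poly" and n assume n: "degree f \<le> n"
  have deg: "degree (pcompose f [:b, 1:]) = degree f" by (simp add: degree_pcompose)
  have "coeff (pcompose f [:b, 1:]) n = coeff f n"
  proof (cases "degree f = n")
    case True
    then show ?thesis using lead_coeff_comp[of "[:b, 1:]" f] deg by simp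
  next
    case False
    then show ?thesis using n deg by (simp add: coeff_eq_0)
  qed
  then show "degree (app (translate b) f) \<le> n \<and> coeff (app (translate b) f) n = 1 * coeff f n"
    using n deg by simp
qed

text \<open>With e = \<open>opX\<close> this covers y itself (d = 0) and the linear factors of C (d
  = - c).\<close>

lemma triangular_raise:
  assumes "triangular c e" "c \<noteq> 0" "f \<noteq> 0"
  shows "degree (app (mulp [:d, 1:] * e) f) = Suc (degree f)" "app (mulp [:d, 1:] * e) f \<noteq> 0"
proof -
  have c: "coeff (app e f) (degree f) \<noteq> 0" and le: "degree (app e f) \<le> degree f"
    using assms by (auto simp: triangular_def)
  from c have "app e f \<noteq> 0" by auto
  moreover have "degree (app e f) = degree f"
    using le le_degree[OF c] by simp
  ultimately show "degree (app (mulp [:d, 1:] * e) f) = Suc (degree f)" "app (mulp [:d, 1:] * e) f \<noteq> 0"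
    using degree_mult_eq[of "[:d, 1:]" "app e f"] no_zero_divisors[of "[:d, 1:]" "app e f"]
    by (simp_all del: mult_pCons_left)
qed

text \<open>By division with remainder a nonzero element of least degree divides all of J. It is not
  constant because 1 is not in J, and any of its roots is common to J.\<close>

lemma poly_ideal_common_root:
  fixes J :: "'a::alg_closed_field poly set"
  assumes add: "\<And>f g. f \<in> J \<Longrightarrow> g \<in> J \<Longrightarrow> f + g \<in> J"
    and mult: "\<And>h f. f \<in> J \<Longrightarrow> h * f \<in> J" and proper: "1 \<notin> J"
  shows "\<exists>\<mu>. \<forall>f\<in>J. poly f \<mu> = 0"
proof (cases "\<exists>h\<in>J. h \<noteq> 0")
  case True
  then obtain h where h: "h \<in> J" "h \<noteq> 0" and least: "\<And>g. g \<in> J \<Longrightarrow> g \<noteq> 0 \<Longrightarrow> degree h \<le> degree g"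
    using arg_min_nat_lemma[of "\<lambda>h. h \<in> J \<and> h \<noteq> 0" _ degree]
      exists_least_iff[of "\<lambda>n. \<exists>h\<in>J. h \<noteq> 0 \<and> degree h = n"]
    by (metis (no_types, lifting) not_less)
  have "degree h > 0"
  proof (rule ccontr)
    assume "\<not> degree h > 0"
    then obtain c where c: "h = [:c:]" using degree_eq_zeroE by blast
    then have "[:inverse c:] * h = 1" using h(2) by (simp add: one_pCons)
    then show False using mult[OF h(1), of "[:inverse c:]"] proper by simp
  qed
  then obtain \<mu> where \<mu>: "poly h \<mu> = 0" using alg_closed_imp_poly_has_root by blast
  have "poly f \<mu> = 0" if "f \<in> J" for f
  proof -
    have "f mod h = f + (- (f div h)) * h" by (simp add: minus_div_mult_eq_mod[symmetric])
    then have "f mod h \<in> J" using add[OF that mult[OF h(1)]] by metis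
    then have "f mod h = 0"
      using least[of "f mod h"] degree_mod_less[OF h(2), of f] by linarith
    then have "h dvd f" by (simp add: mod_eq_0_iff_dvd)
    then show ?thesis using \<mu> by (auto elim!: dvdE)
  qed
  then show ?thesis by blast
\<comment> \<open>Here J has no nonzero element and every point is a common root.\<close>
qed (auto intro!: exI[of _ 0])

section \<open>The polynomial model\<close>

definition left_ideal :: "'r::ring_1 set \<Rightarrow> bool" where
  "left_ideal L \<longleftrightarrow> 0 \<in> L \<and> (\<forall>a\<in>L. \<forall>b\<in>L. a + b \<in> L) \<and> (\<forall>a. \<forall>b\<in>L. a * b \<in> L)"

lemma left_idealD:
  assumes "left_ideal L"
  shows "0 \<in> L" "a \<in> L \<Longrightarrow> b \<in> L \<Longrightarrow> a + b \<in> L" "b \<in> L \<Longrightarrow> c * b \<in> L"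
    "b \<in> L \<Longrightarrow> - b \<in> L" "a \<in> L \<Longrightarrow> b \<in> L \<Longrightarrow> a - b \<in> L"
proof -
  show "0 \<in> L" and add: "a \<in> L \<Longrightarrow> b \<in> L \<Longrightarrow> a + b \<in> L"
    and mult: "b \<in> L \<Longrightarrow> c * b \<in> L" for a b c
    using assms by (auto simp: left_ideal_def)
  show neg: "b \<in> L \<Longrightarrow> - b \<in> L" for b
    using mult[of b "- 1"] by simp
  show "a \<in> L \<Longrightarrow> b \<in> L \<Longrightarrow> a - b \<in> L"
    using add[of a "- b"] neg by simp
qed

definition relator :: "'f::{finite, field} smash" where
  "relator = sx * sy - sy * sx - sgroup 1"

text \<open>
  The choice of \<open>opS\<close> comes from the central element \<open>x\<^sup>2 - 2 g\<^sub>1\<close>, which must act on the cyclic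
  vector \<open>1\<close>, hence everywhere, as \<open>\<alpha>\<^sup>2 - 2\<close>. In characteristic \<open>p\<close> its power \<open>opS ^ p\<close> is the scalar
  \<open>\<alpha> ^ (2 p)\<close>, which makes \<open>opX\<close> a square root of \<open>opS\<close>.
\<close>

locale polynomial_model =
  fixes p :: nat and \<alpha> :: "'f::{finite, field} alg_closure"
  assumes p: "prime p" "odd p" "of_nat p = (0 :: 'f)" and \<alpha>: "\<alpha> \<noteq> 0"
begin

definition opS :: "'f alg_closure poly endo" where
  "opS = mulp [:\<alpha>\<^sup>2 - 2:] + mulp [:2:] * translate 1"

definition opX :: "'f alg_closure poly endo" where
  "opX = mulp [:inverse \<alpha> ^ p:] * opS ^ (Suc p div 2)"

abbreviation opT :: "'f alg_closure poly endo" where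
  "opT \<equiv> mulp [:0, 1:]"

definition opY :: "'f alg_closure poly endo" where
  "opY = opT * opX"

lemma p_alg: "of_nat p = (0 :: 'f alg_closure)"
  using p(3) to_ac_of_nat[of p, where ?'a = 'f] by simp

lemma p_endo: "of_nat p = (0 :: 'f alg_closure poly endo)"
  by (rule endo_eqI) (simp add: mulp_of_nat[symmetric] p_alg)

lemma p_smash: "of_nat p = (0 :: 'f smash)"
proof -
  have "sconst (of_nat n) = (of_nat n :: 'f smash)" for n
    by (induction n) (simp_all add: sconst_add)
  from this[of p] show ?thesis by (simp add: p_alg)
qed

lemma opS_const: "opS * mulp [:c:] = mulp [:c:] * opS"
  by (simp only: opS_def distrib_left distrib_right mult.assoc translate_const)
    (simp only: mult.assoc[symmetric] mulp_commute)

lemma opS_translate: "opS * translate a = translate a * opS"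
proof -
  have "(mulp [:2:] * translate 1) * translate a = translate a * (mulp [:2:] * translate 1)"
    unfolding mult.assoc translate_commute[of 1 a]
    by (simp only: mult.assoc[symmetric] translate_const)
  then show ?thesis
    by (simp only: opS_def distrib_left distrib_right translate_const)
qed

lemma opX_const: "opX * mulp [:c:] = mulp [:c:] * opX"
  by (simp only: opX_def mult.assoc commute_power[OF opS_const])
    (simp only: mult.assoc[symmetric] mulp_commute)

lemma opX_translate: "opX * translate a = translate a * opX"
  by (simp only: opX_def mult.assoc commute_power[OF opS_translate])
    (simp only: mult.assoc[symmetric] translate_const)

lemma opS_T: "opS * opT = opT * opS + mulp [:2:] * translate 1"
proof (rule endo_eqI)
  fix v :: "'f alg_closure poly"
  have "pcompose ([:0, 1:] * v) [:1, 1:] = ([:0, 1:] + 1) * pcompose v [:1, 1:]"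
    unfolding pcompose_mult by (simp add: pcompose_pCons one_pCons)
  then show "app (opS * opT) v = app (opT * opS + mulp [:2:] * translate 1) v"
    unfolding opS_def app_ring app_mulp app_translate by (simp only: ring_distribs mult_1 mult_ac add_ac)
qed

text \<open>Frobenius is used twice: forward to separate the two summands, where g_1 disappears
  because its p-th power is translation by p = 0, and backward to recombine the scalars (\<alpha>^2
  - 2)^p + 2^p into (\<alpha>^2)^p.\<close>

lemma opS_p: "opS ^ p = mulp [:\<alpha> ^ (2 * p):]"
proof -
  let ?a = "mulp [:\<alpha>\<^sup>2 - 2:]" and ?b = "mulp [:2:]" and ?z = "translate 1 :: 'f alg_closure poly endo"
  have z_pow: "?z ^ n = translate (of_nat n)" for n
    by (induction n) (simp_all add: translate_add)
  have bz: "(?b * ?z) ^ n = ?b ^ n * ?z ^ n" for n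
  proof (induction n)
    case (Suc n)
    have "(?b * ?z) ^ Suc n = ?b * (?z * ?b ^ n) * ?z ^ n"
      by (simp only: power_Suc Suc mult.assoc)
    also have "?z * ?b ^ n = ?b ^ n * ?z"
      by (simp only: commute_power translate_const mulp_const_power[symmetric])
    finally show ?case by (simp only: mult.assoc power_Suc)
  qed simp
  have "opS ^ p = ?a ^ p + (?b * ?z) ^ p"
    unfolding opS_def
  proof (rule freshmans_dream_commute)
    show "?a * (?b * ?z) = ?b * ?z * ?a"
      by (simp only: mult.assoc translate_const) (simp only: mult.assoc[symmetric] mulp_commute)
  qed (use p p_endo in auto)
  also have "(?b * ?z) ^ p = ?b ^ p"
    by (simp add: bz z_pow p_alg)
  also have "?a ^ p + ?b ^ p = (?a + ?b) ^ p"
    by (rule freshmans_dream_commute[symmetric]) (use p p_endo mulp_commute in auto)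
  also have "?a + ?b = mulp [:\<alpha>\<^sup>2:]"
    by (simp only: mulp_const_add[symmetric]) simp
  finally show ?thesis
    by (simp only: mulp_const_power[symmetric] power_mult)
qed

lemma alpha_cancel: "inverse \<alpha> ^ p * inverse \<alpha> ^ p * \<alpha> ^ (2 * p) = 1"
proof -
  have "inverse \<alpha> * inverse \<alpha> * \<alpha>\<^sup>2 = 1"
    using \<alpha> by (simp add: power2_eq_square field_simps)
  then show ?thesis
    by (simp only: power_mult power_mult_distrib[symmetric] power_one)
qed

lemma half_p: "2 * (Suc p div 2) = Suc p"
  using p(2) by simp

lemma opX_opX: "opX * opX = opS"
proof -
  have "opX * opX = mulp [:inverse \<alpha> ^ p:] * (opS ^ (Suc p div 2) * mulp [:inverse \<alpha> ^ p:]) * opS ^ (Suc p div 2)"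
    by (simp only: opX_def mult.assoc)
  also have "\<dots> = mulp [:inverse \<alpha> ^ p * inverse \<alpha> ^ p:] * (opS ^ (Suc p div 2) * opS ^ (Suc p div 2))"
    unfolding commute_power[OF opS_const] mulp_const_mult by (simp only: mult.assoc)
  also have "opS ^ (Suc p div 2) * opS ^ (Suc p div 2) = opS ^ p * opS"
    by (simp only: power_add[symmetric] mult_2[symmetric] half_p power_Suc2)
  also have "mulp [:inverse \<alpha> ^ p * inverse \<alpha> ^ p:] * (opS ^ p * opS) = mulp [:inverse \<alpha> ^ p * inverse \<alpha> ^ p * \<alpha> ^ (2 * p):] * opS"
    by (simp only: opS_p mulp_const_mult mult.assoc)
  also have "inverse \<alpha> ^ p * inverse \<alpha> ^ p * \<alpha> ^ (2 * p) = 1"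
    by (rule alpha_cancel)
  finally show ?thesis by (simp add: mulp_const_1)
qed

lemma opX_opT: "opX * opT = opT * opX + mulp [:inverse \<alpha> ^ p:] * (translate 1 * opS ^ (Suc p div 2 - 1))"
proof -
  obtain n where n: "Suc p div 2 = Suc n" using half_p by (cases "Suc p div 2") auto
  have "of_nat (Suc p div 2) * (2 :: 'f alg_closure) = of_nat (2 * (Suc p div 2))"
    by simp
  also have "\<dots> = 1" unfolding half_p by (simp add: p_alg)
  \<comment> \<open>The factor n + 1 = (p+1)/2 from differentiating the power cancels the 2 in
    [S, t] = 2 g_1.\<close>
  finally have h: "of_nat (Suc n) * (2 :: 'f alg_closure) = 1" by (simp only: n)
  have "of_nat (Suc n) * (mulp [:2:] * translate 1 * opS ^ n)
     = mulp [:of_nat (Suc n) * 2:] * (translate 1 * opS ^ n)"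
    by (simp only: mulp_of_nat[symmetric] mulp_const_mult mult.assoc)
  also have "\<dots> = translate 1 * opS ^ n"
    unfolding h by (simp add: mulp_const_1)
  finally have w: "of_nat (Suc n) * (mulp [:2:] * translate 1 * opS ^ n) = translate 1 * opS ^ n" .
  have "opS * (mulp [:2:] * translate 1) = mulp [:2:] * translate 1 * opS"
    by (simp only: mult.assoc[symmetric] opS_const) (simp only: mult.assoc opS_translate)
  from power_commutator[OF opS_T this, of n]
  have "opS ^ Suc n * opT = opT * opS ^ Suc n + translate 1 * opS ^ n"
    unfolding w .
  then have "opX * opT = mulp [:inverse \<alpha> ^ p:] * (opT * opS ^ Suc n + translate 1 * opS ^ n)"
    by (simp only: opX_def n mult.assoc)
  then show ?thesis
    by (simp only: opX_def n distrib_left diff_Suc_1 mult.assoc[symmetric] mulp_commute)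
qed

lemma opX_opY: "opX * opY = opY * opX + translate 1"
proof -
  let ?n = "Suc p div 2 - 1"
  \<comment> \<open>The exponents (p+1)/2 of x and (p-1)/2 of [x, t] add up to p, and S^p is the
    scalar that cancels \<alpha>^(-2p).\<close>
  have n: "Suc p div 2 + ?n = p" using half_p by linarith
  have "opX * opY = opY * opX + mulp [:inverse \<alpha> ^ p:] * (translate 1 * (opS ^ ?n * opX))"
    unfolding opY_def mult.assoc[symmetric] opX_opT by (simp only: distrib_right mult.assoc)
  also have "opS ^ ?n * opX = mulp [:inverse \<alpha> ^ p:] * opS ^ p"
    unfolding opX_def mult.assoc[symmetric] commute_power[OF opS_const]
    by (simp only: mult.assoc power_add[symmetric] n add.commute[of ?n])
  also have "mulp [:inverse \<alpha> ^ p:] * (translate 1 * (mulp [:inverse \<alpha> ^ p:] * opS ^ p)) =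
      mulp [:inverse \<alpha> ^ p * inverse \<alpha> ^ p * \<alpha> ^ (2 * p):] * translate 1"
    unfolding opS_p mulp_const_mult[symmetric] translate_const
    by (simp only: mult.assoc[symmetric] mulp_const_mult)
  also have "inverse \<alpha> ^ p * inverse \<alpha> ^ p * \<alpha> ^ (2 * p) = 1"
    by (rule alpha_cancel)
  finally show ?thesis by (simp add: mulp_const_1)
qed

lemma translate_opY: "translate a * opY = (opY + mulp [:a:] * opX) * translate a"
proof -
  have "translate a * opT = (opT + mulp [:a:]) * translate a"
    by (simp add: translate_mulp pcompose_pCons mulp_add[symmetric])
  then have "translate a * opY = (opT + mulp [:a:]) * (translate a * opX)"
    unfolding opY_def by (simp only: mult.assoc[symmetric])
  then show ?thesis
    unfolding opX_translate[symmetric] opY_def by (simp only: distrib_right mult.assoc)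
qed

lemma opS_1: "app (opS ^ n) 1 = [:\<alpha> ^ (2 * n):]"
proof (induction n)
  case (Suc n)
  have "app opS [:c:] = [:\<alpha>\<^sup>2 * c:]" for c
    by (simp add: opS_def algebra_simps)
  then show ?case using Suc by (simp add: power2_eq_square)
qed (simp add: one_pCons)

lemma opX_1: "app opX 1 = [:\<alpha>:]"
  unfolding opX_def app_ring opS_1 half_p using \<alpha> by (simp add: field_simps)

lemma triangular_opX: "triangular \<alpha> opX"
proof -
  have "triangular (\<alpha>\<^sup>2) opS"
    using triangular_add[OF triangular_const triangular_mult[OF triangular_const triangular_trans], of "\<alpha>\<^sup>2 - 2" 2 1]
    by (simp add: opS_def)
  from triangular_mult[OF triangular_const triangular_power[OF this]]
  have "triangular (inverse \<alpha> ^ p * (\<alpha>\<^sup>2) ^ (Suc p div 2)) opX"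
    by (simp add: opX_def)
  also have "(\<alpha>\<^sup>2) ^ (Suc p div 2) = \<alpha> ^ Suc p"
    by (simp only: power_mult[symmetric] half_p)
  also have "inverse \<alpha> ^ p * \<alpha> ^ Suc p = \<alpha>"
    using \<alpha> by (simp add: field_simps)
  finally show ?thesis .
qed

section \<open>The representation on k[t] and the orbit map of the vector 1\<close>

sublocale rho: smash_evaluation "\<lambda>c. mulp [:c:]" "case_letter opX opY" "\<lambda>a. translate (to_ac a)"
proof
  show "case_letter opX opY i * mulp [:a:] = mulp [:a:] * case_letter opX opY i" for i a
  proof (cases i)
    case LY
    then show ?thesis
      by (simp only: letter.case opY_def mult.assoc opX_const) (simp only: mult.assoc[symmetric] mulp_commute)
  qed (simp add: opX_const)
qed (simp_all add: mulp_const_add mulp_const_mult mulp_const_1 translate_add translate_const opX_translate translate_opY)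

abbreviation \<rho> :: "'f smash \<Rightarrow> 'f alg_closure poly endo" where "\<rho> \<equiv> rho.sev"

definition \<psi> :: "'f smash \<Rightarrow> 'f alg_closure poly" where
  "\<psi> F = app (\<rho> F) 1"

lemma rho_generators [simp]:
  "\<rho> sx = opX" "\<rho> sy = opY" "\<rho> (sconst c) = mulp [:c:]" "\<rho> (sgroup a) = translate (to_ac a)"
  by (simp_all add: rho.sev_sx rho.sev_sy rho.sev_sconst rho.sev_sgroup)

lemma rho_relator: "\<rho> relator = 0"
  by (simp add: relator_def rho.sev_diff rho.sev_mult opX_opY)

lemma psi_add: "\<psi> (F + G) = \<psi> F + \<psi> G" and psi_diff: "\<psi> (F - G) = \<psi> F - \<psi> G"
  and psi_mult: "\<psi> (F * G) = app (\<rho> F) (\<psi> G)" and psi_0: "\<psi> 0 = 0" and psi_1: "\<psi> 1 = 1"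
  by (simp_all add: \<psi>_def rho.sev_add rho.sev_diff rho.sev_mult)

text \<open>An element that acts as t = y x^(-1). The inverse of x is written as x^(2p-1)
  \<alpha>^(-2p), because x^(2p) acts as S^p = \<alpha>^(2p).\<close>

definition \<tau> :: "'f smash" where
  "\<tau> = sy * (sx ^ (2 * p - 1) * sconst (inverse \<alpha> ^ (2 * p)))"

lemma opX_right_inverse: "opX * \<rho> (sx ^ (2 * p - 1) * sconst (inverse \<alpha> ^ (2 * p))) = 1"
proof -
  have p0: "2 * p = Suc (2 * p - 1)" using p(1) prime_gt_0_nat[of p] by simp
  have "opX * opX ^ (2 * p - 1) = opX ^ (2 * p)"
    by (subst (2) p0) (rule power_Suc[symmetric])
  also have "\<dots> = mulp [:\<alpha> ^ (2 * p):]"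
    unfolding power_mult[of opX] power2_eq_square opX_opX opS_p ..
  finally have "opX * \<rho> (sx ^ (2 * p - 1) * sconst (inverse \<alpha> ^ (2 * p))) =
      mulp [:\<alpha> ^ (2 * p) * inverse \<alpha> ^ (2 * p):]"
    by (simp only: rho.sev_mult rho.sev_power rho_generators mult.assoc[symmetric] mulp_const_mult)
  also have "\<alpha> ^ (2 * p) * inverse \<alpha> ^ (2 * p) = 1"
    using \<alpha> by (simp add: power_mult_distrib[symmetric])
  finally show ?thesis by (simp add: mulp_const_1)
qed

lemma rho_tau: "\<rho> \<tau> = opT"
proof -
  have "\<rho> \<tau> = opT * (opX * \<rho> (sx ^ (2 * p - 1) * sconst (inverse \<alpha> ^ (2 * p))))"
    unfolding \<tau>_def rho.sev_mult[of sy] rho_generators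
    unfolding opY_def mult.assoc ..
  then show ?thesis unfolding opX_right_inverse by simp
qed

lemma rho_surj_mulp: "\<exists>F. \<rho> F = mulp h"
proof (induction h)
  case 0
  show ?case by (rule exI[of _ 0]) simp
next
  case (pCons a h)
  then obtain F where "\<rho> F = mulp h" by blast
  moreover have "pCons a h = [:a:] + [:0, 1:] * h" by simp
  ultimately have "\<rho> (sconst a + \<tau> * F) = mulp (pCons a h)"
    by (simp only: rho.sev_add rho.sev_mult rho_generators rho_tau mulp_add mulp_mult)
  then show ?case by blast
qed

lemma psi_surj: "\<exists>F. \<psi> F = h"
proof -
  obtain F where "\<rho> F = mulp h" using rho_surj_mulp by blast
  then have "\<psi> F = h" by (simp add: \<psi>_def)
  then show ?thesis ..
qed

lemma psi_y_power: "degree (\<psi> (sy ^ n)) = n \<and> \<psi> (sy ^ n) \<noteq> 0"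
proof (induction n)
  case (Suc n)
  have "\<psi> (sy ^ Suc n) = app opY (\<psi> (sy ^ n))"
    by (simp only: power_Suc psi_mult rho_generators)
  then show ?case
    using triangular_raise[OF triangular_opX \<alpha>, of "\<psi> (sy ^ n)" 0] Suc
    unfolding opY_def by simp
qed (simp add: psi_1)

end

section \<open>Left ideals\<close>

lemma prod_list_intertwine:
  fixes g :: "'a::monoid_mult"
  assumes "\<And>i. g * A i = B i * g"
  shows "g * prod_list (map A is) = prod_list (map B is) * g"
proof (induction "is")
  case (Cons i "is")
  have "g * prod_list (map A (i # is)) = B i * (g * prod_list (map A is))"
    by (simp add: assms mult.assoc[symmetric])
  then show ?case unfolding Cons by (simp add: mult.assoc)
qed simp

section \<open>Admissible left ideals and the kernel of the orbit map\<close>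

context polynomial_model
begin

text \<open>Together with closure under left multiplication, the right multiples of the relator
  account for the whole two-sided ideal of relations, so these sets correspond to left ideals of
  H.\<close>

definition admissible :: "'f smash set \<Rightarrow> bool" where
  "admissible L \<longleftrightarrow> left_ideal L \<and> (\<forall>F. relator * F \<in> L) \<and>
     sx - sconst \<alpha> \<in> L \<and> (\<forall>a. sgroup a - 1 \<in> L)"

text \<open>This is D plus the k-span of the first n powers of y. Proving that these sets exhaust
  the algebra takes the place of a normal form theorem.\<close>

primrec filt :: "'f smash set \<Rightarrow> nat \<Rightarrow> 'f smash set" where
  "filt D 0 = D"
| "filt D (Suc n) = {sconst c * sy ^ n + u |c u. u \<in> filt D n}"

context
  fixes D assumes D: "admissible D"
begin

lemma left_ideal_D: "left_ideal D"
  using D by (simp add: admissible_def)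

lemma filt_mono: "filt D n \<subseteq> filt D (Suc n)"
proof
  fix u assume "u \<in> filt D n"
  then have "sconst 0 * sy ^ n + u \<in> filt D (Suc n)" by (simp only: filt.simps) blast
  then show "u \<in> filt D (Suc n)" by simp
qed

lemma filt_mono': "m \<le> n \<Longrightarrow> filt D m \<subseteq> filt D n"
  using filt_mono by (rule lift_Suc_mono_le)

lemma filt_add: "u \<in> filt D n \<Longrightarrow> v \<in> filt D n \<Longrightarrow> u + v \<in> filt D n"
proof (induction n arbitrary: u v)
  case 0
  then show ?case using left_idealD(2)[OF left_ideal_D] by simp
next
  case (Suc n)
  from Suc.prems obtain c u' d v' where
    u: "u = sconst c * sy ^ n + u'" "u' \<in> filt D n" and v: "v = sconst d * sy ^ n + v'" "v' \<in> filt D n"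
    by auto
  have "u + v = sconst (c + d) * sy ^ n + (u' + v')"
    unfolding u v sconst_add distrib_right by (simp only: ac_simps)
  then show ?case using Suc.IH[OF u(2) v(2)] by auto
qed

lemma filt_const: "u \<in> filt D n \<Longrightarrow> sconst c * u \<in> filt D n"
proof (induction n arbitrary: u)
  case 0
  then show ?case using left_idealD(3)[OF left_ideal_D] by simp
next
  case (Suc n)
  from Suc.prems obtain d u' where u: "u = sconst d * sy ^ n + u'" "u' \<in> filt D n" by auto
  have "sconst c * u = sconst (c * d) * sy ^ n + sconst c * u'"
    unfolding u sconst_mult distrib_left by (simp only: mult.assoc)
  then show ?case using Suc.IH[OF u(2)] by auto
qed

lemma filt_0: "0 \<in> filt D n"
  using filt_mono'[of 0 n] left_idealD(1)[OF left_ideal_D] by auto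

lemma y_power_filt: "sy ^ n \<in> filt D (Suc n)"
proof -
  have "sconst 1 * sy ^ n + 0 \<in> filt D (Suc n)" using filt_0[of n] by (simp only: filt.simps) blast
  then show ?thesis by simp
qed

lemma filt_y: "u \<in> filt D n \<Longrightarrow> sy * u \<in> filt D (Suc n)"
proof (induction n arbitrary: u)
  case 0
  then have "sy * u \<in> filt D 0" using left_idealD(3)[OF left_ideal_D] by simp
  then show ?case using filt_mono by blast
next
  case (Suc n)
  from Suc.prems obtain d u' where u: "u = sconst d * sy ^ n + u'" "u' \<in> filt D n" by auto
  have "sy * (sconst d * sy ^ n) = sconst d * sy ^ Suc n"
    by (simp only: mult.assoc[symmetric] sconst_central power_Suc)
  then have "sy * u = sconst d * sy ^ Suc n + sy * u'"
    unfolding u distrib_left by (simp only:)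
  then show ?case using filt_add filt_const y_power_filt[of "Suc n"] filt_mono Suc.IH[OF u(2)] by auto
qed

text \<open>Neither x nor a group element raises the degree in y: they are moved past the leading y
  by x y = y x + g_1 + \<open>relator\<close> and g y = (y + b x) g until they meet 1, where they
  agree with \<alpha> and 1 modulo D. Each of these rules produces a term of the other kind, so both
  claims share one induction.\<close>

lemma filt_x_group: "u \<in> filt D n \<Longrightarrow> sx * u \<in> filt D n \<and> sgroup b * u \<in> filt D n"
proof (induction n arbitrary: u b)
  case 0
  then show ?case using left_idealD(3)[OF left_ideal_D] by simp
next
  case (Suc n)
  have y: "sx * sy ^ n \<in> filt D (Suc n) \<and> sgroup b * sy ^ n \<in> filt D (Suc n)" for b
  proof (cases n)
    case 0
    have "sx * sy ^ 0 = sconst \<alpha> * sy ^ 0 + (sx - sconst \<alpha>)"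
      and "sgroup b * sy ^ 0 = sconst 1 * sy ^ 0 + (sgroup b - 1)" by simp_all
    moreover have "sx - sconst \<alpha> \<in> filt D 0" "sgroup b - 1 \<in> filt D 0"
      using D by (simp_all add: admissible_def)
    ultimately show ?thesis unfolding 0 filt.simps(2) by blast
  next
    case (Suc m)
    have ym: "sy ^ m \<in> filt D n" using y_power_filt[of m] Suc by simp
    \<comment> \<open>The relation is applied in front of y^m, which is why right multiples of the
      relator must lie in D.\<close>
    have rel: "relator * sy ^ m \<in> filt D (Suc n)"
      using filt_mono'[of 0 "Suc n"] D by (auto simp: admissible_def)
    have e1: "sx * sy ^ n = sy * (sx * sy ^ m) + (sgroup 1 * sy ^ m + relator * sy ^ m)"
      by (simp add: Suc relator_def algebra_simps)
    have "sy * (sx * sy ^ m) \<in> filt D (Suc n)" and "sgroup 1 * sy ^ m \<in> filt D (Suc n)"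
      using filt_y filt_mono Suc.IH[OF ym] by blast+
    then have x: "sx * sy ^ n \<in> filt D (Suc n)"
      unfolding e1 by (intro filt_add rel)
    have g: "sgroup b * sy ^ m \<in> filt D n" for b using Suc.IH[OF ym] by blast
    have "sgroup b * sy ^ n = (sgroup b * sy) * sy ^ m" for b
      by (simp only: Suc power_Suc mult.assoc)
    then have e: "sgroup b * sy ^ n =
        sy * (sgroup b * sy ^ m) + sconst (to_ac b) * (sx * (sgroup b * sy ^ m))" for b
      unfolding sgroup_sy by (simp only: distrib_right mult.assoc)
    have "sgroup b * sy ^ n \<in> filt D (Suc n)" for b
      unfolding e using Suc.IH[OF g]
      by (intro filt_add filt_y filt_const g) (blast intro: subsetD[OF filt_mono])
    with x show ?thesis by blast
  qed
  from Suc.prems obtain d u' where u: "u = sconst d * sy ^ n + u'" "u' \<in> filt D n" by auto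
  have *: "a * u = sconst d * (a * sy ^ n) + a * u'" for a
    unfolding u distrib_left by (simp only: mult.assoc[symmetric] sconst_central)
  show ?case
    unfolding * using y[of b] Suc.IH[OF u(2)]
    by (intro conjI filt_add filt_const) (blast intro: subsetD[OF filt_mono])+
qed

lemma filt_exhausts: "\<exists>n. F \<in> filt D n"
proof (induction F rule: smash_induct)
  case one
  show ?case using y_power_filt[of 0] by (auto simp del: filt.simps)
next
  case (add F G)
  then obtain m n where "F \<in> filt D m" "G \<in> filt D n" by blast
  then have "F \<in> filt D (max m n)" "G \<in> filt D (max m n)"
    using filt_mono'[of m "max m n"] filt_mono'[of n "max m n"] by auto
  then show ?case using filt_add by blast
qed (use filt_const filt_y filt_x_group in blast)+

end

text \<open>Modulo the left ideal, F is a combination of powers of y. Their images have distinct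
  degrees, so the combination must be trivial when F is mapped to 0.\<close>

lemma psi_kernel:
  assumes D: "admissible D" and F: "\<psi> F = 0"
  shows "F \<in> D"
proof -
  \<comment> \<open>\<open>\<psi>\<close> need not vanish on \<open>D\<close>, but it vanishes on \<open>K\<close>, which is still admissible.\<close>
  define K where "K = {F \<in> D. \<psi> F = 0}"
  have "left_ideal D" using D by (simp add: admissible_def)
  then have "left_ideal K"
    using left_idealD by (auto simp: left_ideal_def K_def psi_0 psi_add psi_mult)
  moreover have "relator * G \<in> K" "sx - sconst \<alpha> \<in> K" "sgroup a - 1 \<in> K" for G a
    using D by (auto simp: admissible_def K_def psi_mult rho_relator psi_diff psi_1)
      (simp_all add: \<psi>_def opX_1 pcompose_1)
  ultimately have K: "admissible K" by (simp add: admissible_def)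
  have deg: "coeff (\<psi> G) m = 0" if "G \<in> filt K n" "m \<ge> n" for G m n
    using that
  proof (induction n arbitrary: G)
    case 0
    then show ?case by (simp add: K_def)
  next
    case (Suc n)
    then obtain c u where G: "G = sconst c * sy ^ n + u" "u \<in> filt K n" by auto
    have "coeff (\<psi> (sy ^ n)) m = 0" using psi_y_power[of n] Suc.prems by (simp add: coeff_eq_0)
    then show ?case using Suc.IH[OF G(2)] Suc.prems by (simp add: G(1) psi_add psi_mult)
  qed
  have "G \<in> K" if "G \<in> filt K n" "\<psi> G = 0" for G n
    using that
  proof (induction n arbitrary: G)
    case (Suc n)
    then obtain c u where G: "G = sconst c * sy ^ n + u" "u \<in> filt K n" by auto
    \<comment> \<open>The summand from \<open>filt K n\<close> has an image of degree below n, so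
      the coefficient of t^n sees only c y^n.\<close>
    have "coeff (\<psi> G) n = c * coeff (\<psi> (sy ^ n)) n"
      using deg[OF G(2), of n] by (simp add: G(1) psi_add psi_mult)
    moreover have "coeff (\<psi> (sy ^ n)) n \<noteq> 0"
      using psi_y_power[of n] by (metis leading_coeff_0_iff)
    ultimately have "c = 0" using Suc.prems by simp
    then show ?case using Suc G by simp
  qed simp
  then show ?thesis using filt_exhausts[OF K, of F] F by (auto simp: K_def)
qed

section \<open>Left ideals attached to cosets of F_q in k\<close>

definition vanishing :: "'f alg_closure \<Rightarrow> 'f smash set" where
  "vanishing \<mu> = {F. \<forall>b. poly (\<psi> F) (\<mu> + to_ac b) = 0}"

text \<open>Translations by F_q permute the points of the coset and multiplications preserve zeros.
  The operators x and y are built from these two kinds.\<close>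

lemma rho_vanishing:
  assumes "\<forall>b. poly f (\<mu> + to_ac b) = 0"
  shows "poly (app (\<rho> F) f) (\<mu> + to_ac b) = 0"
proof -
  define J where "J = {f :: 'f alg_closure poly. \<forall>b. poly f (\<mu> + to_ac b) = 0}"
  have J_add: "f + g \<in> J" if "f \<in> J" "g \<in> J" for f g using that by (simp add: J_def)
  have J_mult: "h * f \<in> J" if "f \<in> J" for f h using that by (simp add: J_def)
  have J_const: "app (mulp [:c:]) f \<in> J" if "f \<in> J" for f c using that by (simp add: J_def)
  have J_translate: "app (translate (to_ac a)) f \<in> J" if f: "f \<in> J" for f a
  proof -
    have eq: "to_ac a + (\<mu> + to_ac b) = \<mu> + to_ac (a + b)" for b
      by (simp add: algebra_simps)
    have "poly f (to_ac a + (\<mu> + to_ac b)) = 0" for b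
      unfolding eq using f by (simp only: J_def mem_Collect_eq)
    then show ?thesis by (simp add: J_def poly_pcompose add.commute)
  qed
  have J_S: "app opS f \<in> J" if "f \<in> J" for f
    unfolding opS_def app_ring using J_translate[of f 1] by (intro J_add J_const that) (simp add: that)
  have "app (opS ^ n) f \<in> J" if "f \<in> J" for f n
    using that by (induction n) (simp_all add: J_S)
  then have J_X: "app opX f \<in> J" if "f \<in> J" for f
    using J_const that by (simp only: opX_def app_ring)
  then have J_Y: "app opY f \<in> J" if "f \<in> J" for f
    using J_mult that by (simp only: opY_def app_ring app_mulp)
  have "app (\<rho> F) f \<in> J" if "f \<in> J" for f
  proof (induction F rule: smash_induct)
    case one
    then show ?case using that by simp
  qed (use J_const J_X J_Y J_translate J_add in \<open>auto simp only: rho.sev_mult rho.sev_add app_ring rho_generators\<close>)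
  then show ?thesis using assms by (simp add: J_def)
qed

lemma admissible_vanishing: "admissible (vanishing \<mu>)"
  unfolding admissible_def left_ideal_def vanishing_def
  using rho_vanishing
  by (auto simp: psi_0 psi_add psi_mult rho_relator psi_diff psi_1)
    (simp_all add: \<psi>_def opX_1 pcompose_1)

lemma one_notin_vanishing: "1 \<notin> vanishing \<mu>"
  by (simp add: vanishing_def psi_1)

text \<open>The image of L in k[t] is an ideal because multiplications by polynomials come from the
  algebra. It is proper because L contains the kernel of \<open>\<psi>\<close>: if F in L were
  mapped to 1, then F - 1 and hence 1 would lie in L. The group elements spread one common root over
  its coset.\<close>

lemma admissible_subset_vanishing:
  assumes L: "admissible L" and proper: "1 \<notin> L"
  shows "\<exists>\<mu>. L \<subseteq> vanishing \<mu>"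
proof -
  have id: "left_ideal L" using L by (simp add: admissible_def)
  have "\<exists>\<mu>. \<forall>f\<in>\<psi> ` L. poly f \<mu> = 0"
  proof (rule poly_ideal_common_root)
    show "f + g \<in> \<psi> ` L" if "f \<in> \<psi> ` L" "g \<in> \<psi> ` L" for f g
      using that left_idealD(2)[OF id] by (auto simp: psi_add[symmetric])
    show "h * f \<in> \<psi> ` L" if f: "f \<in> \<psi> ` L" for f h
    proof -
      obtain F where F: "f = \<psi> F" "F \<in> L" using f by blast
      obtain G where "\<rho> G = mulp h" using rho_surj_mulp by blast
      then have "h * f = \<psi> (G * F)" by (simp add: psi_mult F)
      then show ?thesis using left_idealD(3)[OF id F(2)] by blast
    qed
    show "1 \<notin> \<psi> ` L"
    proof
      assume "1 \<in> \<psi> ` L"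
      then obtain F where F: "\<psi> F = 1" "F \<in> L" by force
      then have "F - 1 \<in> L" using psi_kernel[OF L, of "F - 1"] by (simp add: psi_diff psi_1)
      then have "F - (F - 1) \<in> L" using left_idealD(5)[OF id F(2)] by blast
      then show False using proper by simp
    qed
  qed
  then obtain \<mu> where \<mu>: "poly (\<psi> F) \<mu> = 0" if "F \<in> L" for F by blast
  have "poly (\<psi> F) (\<mu> + to_ac b) = 0" if "F \<in> L" for F b
    using \<mu>[OF left_idealD(3)[OF id that, of "sgroup b"]]
    by (simp add: psi_mult poly_pcompose add.commute)
  then show ?thesis unfolding vanishing_def by blast
qed

definition roots_poly :: "'f alg_closure \<Rightarrow> 'f set \<Rightarrow> 'f alg_closure poly" where
  "roots_poly \<mu> B = (\<Prod>b\<in>B. [:- (\<mu> + to_ac b), 1:])"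

lemma poly_roots_poly: "poly (roots_poly \<mu> B) x = 0 \<longleftrightarrow> (\<exists>b\<in>B. x = \<mu> + to_ac b)"
  unfolding roots_poly_def poly_prod by (subst prod_zero_iff) (auto simp: algebra_simps)

text \<open>L lies below some \<open>vanishing \<nu>\<close>. The polynomial whose roots are exactly
  \<mu> + F_q has to vanish at \<nu>, so \<mu> and \<nu> define the same coset.\<close>

lemma vanishing_maximal:
  assumes L: "admissible L" and proper: "1 \<notin> L" and sub: "vanishing \<mu> \<subseteq> L"
  shows "L = vanishing \<mu>"
proof -
  obtain \<nu> where \<nu>: "L \<subseteq> vanishing \<nu>" using admissible_subset_vanishing[OF L proper] by blast
  obtain F where F: "\<psi> F = roots_poly \<mu> UNIV" using psi_surj by blast
  then have "F \<in> vanishing \<mu>" by (auto simp: vanishing_def poly_roots_poly)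
  then have "F \<in> vanishing \<nu>" using sub \<nu> by blast
  then have "poly (roots_poly \<mu> UNIV) (\<nu> + to_ac 0) = 0"
    unfolding vanishing_def F[symmetric] by blast
  then obtain c where c: "\<nu> = \<mu> + to_ac c" by (auto simp: poly_roots_poly)
  have "vanishing \<nu> \<subseteq> vanishing \<mu>"
  proof
    fix G assume G: "G \<in> vanishing \<nu>"
    have "poly (\<psi> G) (\<mu> + to_ac b) = 0" for b
    proof -
      have "\<mu> + to_ac b = \<nu> + to_ac (b - c)" by (simp add: c)
      then show ?thesis using G by (simp only: vanishing_def mem_Collect_eq)
    qed
    then show "G \<in> vanishing \<mu>" by (simp add: vanishing_def)
  qed
  then show ?thesis using \<nu> sub by blast
qed

text \<open>Lagrange polynomials lifted to the algebra. Applied to the eigenvector of a simple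
  module they give its basis.\<close>

lemma lagrange_basis:
  "\<exists>l. \<forall>b b'. poly (\<psi> (l b)) (\<mu> + to_ac b') = (if b = b' then 1 else 0)"
proof -
  have "\<exists>F. \<forall>b'. poly (\<psi> F) (\<mu> + to_ac b') = (if b = b' then 1 else 0)" for b
  proof -
    let ?g = "roots_poly \<mu> (UNIV - {b})"
    obtain F where F: "\<psi> F = smult (inverse (poly ?g (\<mu> + to_ac b))) ?g" using psi_surj by blast
    have nz: "poly ?g (\<mu> + to_ac b) \<noteq> 0" by (auto simp: poly_roots_poly)
    have z: "poly ?g (\<mu> + to_ac b') = 0" if "b' \<noteq> b" for b'
      using that by (auto simp: poly_roots_poly)
    show ?thesis by (rule exI[of _ F]) (use nz z in \<open>auto simp: F\<close>)
  qed
  then show ?thesis by metis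
qed

end

section \<open>The element C\<close>

text \<open>The product of y - c x and y - d x expands symmetrically in c and d except for the term
  - c z, which comes from the reordering x y = y x + z.\<close>

lemma commutator_combination:
  fixes x y z a b :: "'r::ring_1"
  assumes "x * y = y * x + z" "y * a = a * y" "y * b = b * y" "x * a = a * x" "x * b = b * x" "a * b = b * a"
  shows "(y - a * x) * (y - b * x) = (y - b * x) * (y - a * x) + (b - a) * z"
proof -
  have e: "(y - c * x) * (y - d * x) = y * y - d * (y * x) - c * (y * x) - c * z + c * d * (x * x)"
    if "y * d = d * y" "x * d = d * x" for c d
  proof -
    have "y * (d * x) = d * (y * x)" "x * (d * x) = d * (x * x)"
      using that by (simp_all only: mult.assoc[symmetric])
    then show ?thesis
      by (simp add: left_diff_distrib right_diff_distrib mult.assoc assms(1) distrib_left)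
  qed
  show ?thesis
    unfolding e[OF assms(3,5)] e[OF assms(2,4)] assms(6) by (simp add: left_diff_distrib)
qed

definition C_smash :: "nat \<Rightarrow> 'f::{finite, field} list \<Rightarrow> 'f smash" where
  "C_smash p \<zeta>s = prod_list (map (\<lambda>\<zeta>. prod_list
     (map (\<lambda>a. sy - sconst (to_ac (\<zeta> + of_nat a)) * sx) [1..<p + 1])) \<zeta>s)"

context polynomial_model
begin

definition opA :: "'f \<Rightarrow> 'f alg_closure poly endo" where
  "opA c = opY - mulp [:to_ac c:] * opX"

definition opP :: "'f \<Rightarrow> 'f alg_closure poly endo" where
  "opP \<zeta> = shifted_prod (\<lambda>n. opA (\<zeta> + of_nat n)) p"

definition polyP :: "'f \<Rightarrow> 'f alg_closure poly" where
  "polyP \<zeta> = app (opP \<zeta>) 1"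

lemma opY_const: "opY * mulp [:c:] = mulp [:c:] * opY"
  by (simp only: opY_def mult.assoc opX_const) (simp only: mult.assoc[symmetric] mulp_commute)

text \<open>Splitting off x on the right allows it to be cancelled by its inverse, and it exhibits
  the rise of the degree by one.\<close>

lemma opA_altdef: "opA c = mulp [:- to_ac c, 1:] * opX"
proof -
  have "[:0, 1:] - [:to_ac c:] = [:- to_ac c, 1:]" by simp
  then show ?thesis
    by (simp only: opA_def opY_def left_diff_distrib[symmetric] mulp_diff[symmetric])
qed

lemma opA_const: "opA c * mulp [:d:] = mulp [:d:] * opA c"
  by (simp only: opA_altdef mult.assoc opX_const) (simp only: mult.assoc[symmetric] mulp_commute)

lemma translate_opA: "translate (to_ac b) * opA c = opA (c - b) * translate (to_ac b)"
proof -
  have "mulp [:to_ac (c - b):] = mulp [:to_ac c:] - mulp [:to_ac b:]"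
    by (simp add: mulp_diff[symmetric])
  then have "opA (c - b) = opY + mulp [:to_ac b:] * opX - mulp [:to_ac c:] * opX"
    by (simp only: opA_def left_diff_distrib) (simp add: algebra_simps)
  moreover have "translate (to_ac b) * (mulp [:to_ac c:] * opX) = mulp [:to_ac c:] * opX * translate (to_ac b)"
    by (simp only: mult.assoc opX_translate) (simp only: mult.assoc[symmetric] translate_const)
  ultimately show ?thesis
    by (simp only: opA_def right_diff_distrib translate_opY left_diff_distrib)
qed

lemma translate_opP: "translate (to_ac b) * opP \<zeta> = opP (\<zeta> - b) * translate (to_ac b)"
  unfolding opP_def shifted_prod_def
  by (rule prod_list_intertwine) (simp add: translate_opA algebra_simps)

lemma opP_commute:
  "opX * opP \<zeta> = opP \<zeta> * opX" "opA \<zeta> * opP \<zeta> = opP \<zeta> * opA \<zeta>"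
  "translate 1 * opP \<zeta> = opP \<zeta> * translate 1"
proof -
  let ?A = "\<lambda>n. opA (\<zeta> + of_nat n)"
  have x_A: "opX * ?A n = ?A n * opX + translate 1" for n
  proof -
    have "opX * (mulp [:c:] * opX) = mulp [:c:] * opX * opX" for c
      by (simp only: mult.assoc[symmetric] opX_const)
    then show ?thesis
      by (simp add: opA_def right_diff_distrib left_diff_distrib opX_opY)
  qed
  have z_A: "translate 1 * ?A (Suc n) = ?A n * translate 1" for n
    using translate_opA[of 1 "\<zeta> + of_nat (Suc n)"] by simp
  have A0_A: "?A 0 * ?A n = ?A n * ?A 0 + of_nat n * translate 1" for n
  proof -
    have "mulp [:to_ac (\<zeta> + of_nat n):] - mulp [:to_ac (\<zeta> + of_nat 0):] =
        (of_nat n :: 'f alg_closure poly endo)"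
      unfolding mulp_of_nat[symmetric] mulp_diff[symmetric] by simp
    then show ?thesis
      using commutator_combination[OF opX_opY opY_const opY_const opX_const opX_const mulp_commute]
      unfolding opA_def by metis
  qed
  have A_p: "?A p = ?A 0" by (simp add: p(3))
  note * = shifted_prod_prime_commute[where A = ?A and x = opX and z = "translate 1" and p = p,
      OF x_A z_A A0_A p(1,2) p_endo A_p]
  show "opX * opP \<zeta> = opP \<zeta> * opX" "translate 1 * opP \<zeta> = opP \<zeta> * translate 1"
    unfolding opP_def by (rule *)+
  show "opA \<zeta> * opP \<zeta> = opP \<zeta> * opA \<zeta>"
    using *(2) unfolding opP_def by simp
qed

text \<open>The product commutes with x and with (t - \<zeta>) x. Cancelling x by its right inverse
  \<open>?E\<close> leaves commutation with t - \<zeta>, hence with t.\<close>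

lemma opP_eq_mulp: "opP \<zeta> = mulp (polyP \<zeta>)"
  unfolding polyP_def
proof (rule endo_eq_mulp)
  have "mulp [:c:] * opA d = opA d * mulp [:c:]" for c d by (simp only: opA_const)
  then show const: "opP \<zeta> * mulp [:c:] = mulp [:c:] * opP \<zeta>" for c
    unfolding opP_def shifted_prod_def by (rule prod_list_intertwine[symmetric])
  let ?l = "mulp [:- to_ac \<zeta>, 1:]"
  let ?E = "\<rho> (sx ^ (2 * p - 1) * sconst (inverse \<alpha> ^ (2 * p)))"
  have "opP \<zeta> * ?l * opX = ?l * opP \<zeta> * opX"
    using opP_commute(2)[of \<zeta>] unfolding opA_altdef mult.assoc opP_commute(1) by simp
  then have "opP \<zeta> * ?l * (opX * ?E) = ?l * opP \<zeta> * (opX * ?E)"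
    by (simp only: mult.assoc[symmetric])
  then have l: "opP \<zeta> * ?l = ?l * opP \<zeta>"
    unfolding opX_right_inverse by simp
  have "opT = ?l + mulp [:to_ac \<zeta>:]"
    by (simp only: mulp_add[symmetric]) simp
  then show "opP \<zeta> * opT = opT * opP \<zeta>"
    by (simp only: distrib_left distrib_right l const)
qed

lemma polyP_translate: "pcompose (polyP \<zeta>) [:to_ac b, 1:] = polyP (\<zeta> - b)"
  using arg_cong[OF translate_opP[of b \<zeta>], of "\<lambda>e. app e 1"]
  by (simp add: polyP_def pcompose_1)

text \<open>Translation by 1 fixes the polynomial, because the product commutes with g_1, and at the
  same time it replaces \<zeta> by \<zeta> - 1.\<close>

lemma polyP_periodic: "polyP (\<zeta> - of_nat n) = polyP \<zeta>"
proof (induction n)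
  case (Suc n)
  have "polyP (\<zeta> - 1) = polyP \<zeta>" for \<zeta>
    using arg_cong[OF opP_commute(3)[of \<zeta>], of "\<lambda>e. app e 1"] polyP_translate[of \<zeta> 1]
    by (simp add: polyP_def pcompose_1)
  from this[of "\<zeta> - of_nat n"] Suc show ?case by (simp add: algebra_simps)
qed simp

lemma degree_polyP: "degree (polyP \<zeta>) = p" "polyP \<zeta> \<noteq> 0"
proof -
  have raise: "degree (app (opA c) f) = Suc (degree f)" "app (opA c) f \<noteq> 0" if "f \<noteq> 0" for c f
    unfolding opA_altdef using triangular_raise[OF triangular_opX \<alpha> that] by blast+
  have *: "degree (app (prod_list (map opA cs)) 1) = length cs \<and> app (prod_list (map opA cs)) 1 \<noteq> 0" for cs
  proof (induction cs)
    case (Cons c cs)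
    then show ?case by (simp add: raise)
  qed simp
  have "polyP \<zeta> = app (prod_list (map opA (map (\<lambda>n. \<zeta> + of_nat n) [1..<p + 1]))) 1"
    by (simp add: polyP_def opP_def shifted_prod_def comp_def)
  then show "degree (polyP \<zeta>) = p" "polyP \<zeta> \<noteq> 0"
    using *[of "map (\<lambda>n. \<zeta> + of_nat n) [1..<p + 1]"] by simp_all
qed

lemma rho_prod_list: "\<rho> (prod_list Fs) = prod_list (map \<rho> Fs)"
  by (induction Fs) (simp_all add: rho.sev_mult)

text \<open>From here on the order in \<open>\<zeta>s\<close> is immaterial, since multiplication
  operators commute.\<close>

lemma psi_C: "\<psi> (C_smash p \<zeta>s) = prod_list (map polyP \<zeta>s)"
proof -
  have A: "\<rho> (sy - sconst (to_ac c) * sx) = opA c" for c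
    by (simp only: rho.sev_diff rho.sev_mult rho_generators opA_def)
  have P: "\<rho> (prod_list (map (\<lambda>a. sy - sconst (to_ac (\<zeta> + of_nat a)) * sx) [1..<p + 1])) = opP \<zeta>" for \<zeta>
    by (simp only: rho_prod_list map_map comp_def A opP_def shifted_prod_def)
  have "\<rho> (C_smash p \<zeta>s) = prod_list (map (\<lambda>\<zeta>. mulp (polyP \<zeta>)) \<zeta>s)"
    by (simp only: C_smash_def rho_prod_list[of "map _ \<zeta>s"] map_map comp_def P opP_eq_mulp)
  also have "\<dots> = mulp (prod_list (map polyP \<zeta>s))"
    by (induction \<zeta>s) (simp_all add: mulp_mult)
  finally show ?thesis by (simp add: \<psi>_def)
qed

text \<open>These are the properties of \<Xi> that matter: Z is a subgroup of index p that together
  with the prime field spans F_q.\<close>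

context
  fixes Z :: "'f set"
  assumes Z_diff: "\<And>\<zeta> \<eta>. \<zeta> \<in> Z \<Longrightarrow> \<eta> \<in> Z \<Longrightarrow> \<zeta> - \<eta> \<in> Z"
    and Z_span: "\<And>b. \<exists>n. \<exists>\<eta>\<in>Z. b = of_nat n + \<eta>"
    and Z_card: "p * card Z = card (UNIV :: 'f set)"
begin

text \<open>Writing b = n + \<eta>, the part n fixes every factor and the part \<eta> permutes the
  factors.\<close>

lemma prod_polyP_translate:
  "pcompose (\<Prod>\<zeta>\<in>Z. polyP \<zeta>) [:to_ac b, 1:] = (\<Prod>\<zeta>\<in>Z. polyP \<zeta>)"
proof -
  obtain n \<eta> where b: "b = of_nat n + \<eta>" "\<eta> \<in> Z" using Z_span by blast
  \<comment> \<open>The sum is written as \<zeta> - ((\<eta> - \<eta>) - \<eta>), because closure is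
    given for differences.\<close>
  have Z_add: "\<zeta> + \<eta> \<in> Z" if "\<zeta> \<in> Z" for \<zeta>
    using Z_diff[OF that Z_diff[OF Z_diff[OF b(2) b(2)] b(2)]] by simp
  have "pcompose (\<Prod>\<zeta>\<in>Z. polyP \<zeta>) [:to_ac b, 1:] = (\<Prod>\<zeta>\<in>Z. polyP (\<zeta> - \<eta>))"
    unfolding pcompose_prod polyP_translate b(1)
    using polyP_periodic[of "_ - \<eta>" n] by (simp add: algebra_simps)
  also have "\<dots> = (\<Prod>\<zeta>\<in>Z. polyP \<zeta>)"
    by (rule prod.reindex_bij_witness[of _ "\<lambda>\<zeta>. \<zeta> + \<eta>" "\<lambda>\<zeta>. \<zeta> - \<eta>"])
      (auto intro: Z_add Z_diff b(2))
  finally show ?thesis .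
qed

text \<open>The polynomial c - \<beta> has degree q and vanishes on the q points \<mu> + F_q, so it
  divides every polynomial that vanishes there: the remainder has degree below q and q roots. The
  cofactor lifts to some G, and F - G (C - \<beta>) lies in the kernel of \<open>\<psi>\<close>,
  which L contains.\<close>

lemma C_generates_vanishing:
  assumes \<zeta>s: "distinct \<zeta>s" "set \<zeta>s = Z"
  shows "\<exists>\<mu>. C_smash p \<zeta>s - sconst \<beta> \<in> vanishing \<mu> \<and>
    (\<forall>L. admissible L \<longrightarrow> C_smash p \<zeta>s - sconst \<beta> \<in> L \<longrightarrow> vanishing \<mu> \<subseteq> L)"
proof -
  define c where "c = (\<Prod>\<zeta>\<in>Z. polyP \<zeta>)"
  let ?q = "card (UNIV :: 'f set)"
  have c: "\<psi> (C_smash p \<zeta>s) = c"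
    by (simp add: psi_C c_def \<zeta>s(2)[symmetric] prod.distinct_set_conv_list[OF \<zeta>s(1)])
  have q: "?q > 0" by (simp add: finite_UNIV_card_ge_0)
  have "degree c = ?q"
    unfolding c_def by (subst degree_prod_sum_eq) (simp_all add: degree_polyP Z_card[symmetric])
  then have deg: "degree (c - [:\<beta>:]) = ?q"
    using q degree_add_eq_left[of "[:- \<beta>:]" c] by (simp add: diff_conv_add_uminus del: add_uminus_conv_diff)
  then obtain \<mu> where \<mu>: "poly (c - [:\<beta>:]) \<mu> = 0"
    using alg_closed_imp_poly_has_root[of "c - [:\<beta>:]"] q by auto
  have psi: "\<psi> (C_smash p \<zeta>s - sconst \<beta>) = c - [:\<beta>:]"
    using psi_mult[of "sconst \<beta>" 1] by (simp add: psi_diff c psi_1 one_pCons)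
  have van: "poly (c - [:\<beta>:]) (\<mu> + to_ac b) = 0" for b
  proof -
    have "poly c (\<mu> + to_ac b) = poly (pcompose c [:to_ac b, 1:]) \<mu>"
      by (simp add: poly_pcompose add.commute)
    also have "\<dots> = poly c \<mu>" by (simp only: c_def prod_polyP_translate)
    finally show ?thesis using \<mu> by simp
  qed
  have "vanishing \<mu> \<subseteq> L" if L: "admissible L" and mem: "C_smash p \<zeta>s - sconst \<beta> \<in> L" for L
  proof
    fix F assume F: "F \<in> vanishing \<mu>"
    define s where "s = \<psi> F mod (c - [:\<beta>:])"
    have nz: "c - [:\<beta>:] \<noteq> 0" using deg q by auto
    have "s = \<psi> F - (\<psi> F div (c - [:\<beta>:])) * (c - [:\<beta>:])"
      by (simp only: s_def minus_div_mult_eq_mod)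
    then have s0: "poly s (\<mu> + to_ac b) = 0" for b
      using F van by (simp only: vanishing_def mem_Collect_eq poly_diff poly_mult mult_zero_right diff_zero)
    have "s = 0"
    proof (rule ccontr)
      assume s: "s \<noteq> 0"
      have "?q = card (range (\<lambda>b :: 'f. \<mu> + to_ac b))"
        by (rule card_image[symmetric]) (auto intro: injI)
      also have "\<dots> \<le> card {x. poly s x = 0}"
        using s0 poly_roots_finite[OF s] by (intro card_mono) auto
      also have "\<dots> \<le> degree s" by (rule card_poly_roots_bound[OF s])
      also have "\<dots> < degree (c - [:\<beta>:])"
        using degree_mod_less[OF nz, of "\<psi> F"] s by (simp add: s_def)
      finally show False by (simp add: deg)
    qed
    then have "c - [:\<beta>:] dvd \<psi> F" by (simp add: s_def mod_eq_0_iff_dvd)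
    then obtain h where h: "\<psi> F = h * (c - [:\<beta>:])" by (metis dvdE mult.commute)
    obtain G where G: "\<rho> G = mulp h" using rho_surj_mulp by blast
    have id: "left_ideal L" using L by (simp add: admissible_def)
    have "\<psi> (F - G * (C_smash p \<zeta>s - sconst \<beta>)) = 0"
      by (simp only: psi_diff[of F] psi_mult[of G] psi G app_mulp h) simp
    then have "F - G * (C_smash p \<zeta>s - sconst \<beta>) \<in> L" by (rule psi_kernel[OF L])
    from left_idealD(2)[OF id this left_idealD(3)[OF id mem, of G]]
    show "F \<in> L" by simp
  qed
  moreover have "C_smash p \<zeta>s - sconst \<beta> \<in> vanishing \<mu>"
    unfolding vanishing_def mem_Collect_eq psi using van by blast
  ultimately show ?thesis by blast
qed

end

end

section \<open>The finite field\<close>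

locale primitive_element =
  fixes p r :: nat and \<xi> :: "'f::{finite, field}"
  assumes prime: "prime p" and r: "r > 0" and card_UNIV: "card (UNIV :: 'f set) = p ^ r"
    and primitive: "range (\<lambda>n::nat. \<xi> ^ n) = UNIV - {0}"
begin

section \<open>The prime field\<close>

definition P :: "'f set" where "P = range of_nat"

lemma PE: "a \<in> P \<Longrightarrow> (\<And>n. a = of_nat n \<Longrightarrow> thesis) \<Longrightarrow> thesis"
  and of_nat_in_P: "of_nat n \<in> P"
  by (auto simp: P_def)

text \<open>Adding 1 permutes the field, so the sum of all elements equals itself plus q; hence q =
  p^r is zero in the field.\<close>

lemma of_nat_p: "of_nat p = (0 :: 'f)"
proof -
  have "(\<Sum>x\<in>(UNIV :: 'f set). x) = (\<Sum>x\<in>UNIV. x + 1)"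
    by (rule sum.reindex_bij_witness[of _ "\<lambda>x. x + 1" "\<lambda>x. x - 1"]) auto
  then have "of_nat (p ^ r) = (0 :: 'f)" by (simp add: sum.distrib card_UNIV)
  then show ?thesis by simp
qed

lemma of_nat_eq_0_iff: "of_nat n = (0 :: 'f) \<longleftrightarrow> p dvd n"
proof
  assume "of_nat n = (0 :: 'f)"
  show "p dvd n"
  proof (rule ccontr)
    assume "\<not> p dvd n"
    then have "coprime p n" using prime by (simp add: prime_imp_coprime)
    then have "CHAR('f) = 1"
      using \<open>of_nat n = 0\<close> of_nat_p by (metis coprime_common_divisor_nat of_nat_eq_0_iff_char_dvd)
    then show False by simp
  qed
qed (auto simp: of_nat_p elim!: dvdE)

lemma card_P: "card P = p"
proof -
  have image: "P = of_nat ` {..<p}"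
  proof (intro equalityI subsetI)
    fix x :: 'f assume "x \<in> P"
    then obtain n where "x = of_nat n" by (rule PE)
    also have "\<dots> = of_nat (p * (n div p) + n mod p)" by simp
    also have "\<dots> = of_nat (n mod p)" by (simp only: of_nat_add of_nat_mult of_nat_p) simp
    finally show "x \<in> of_nat ` {..<p}" using prime prime_gt_0_nat by auto
  qed (auto simp: of_nat_in_P)
  have "inj_on (of_nat :: nat \<Rightarrow> 'f) {..<p}"
  proof (rule linorder_inj_onI)
    fix i j assume ij: "i < j" "i \<in> {..<p}" "j \<in> {..<p}"
    have "\<not> p dvd j - i" using ij dvd_imp_le[of p "j - i"] by auto
    then have "of_nat (j - i) \<noteq> (0 :: 'f)" by (simp only: of_nat_eq_0_iff not_False_eq_True)
    then show "of_nat i \<noteq> (of_nat j :: 'f)" using ij by (simp add: of_nat_diff)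
  qed auto
  then show ?thesis unfolding image by (simp add: card_image)
qed

lemma P_add: "a \<in> P \<Longrightarrow> b \<in> P \<Longrightarrow> a + b \<in> P"
  and P_mult: "a \<in> P \<Longrightarrow> b \<in> P \<Longrightarrow> a * b \<in> P"
  by (metis PE of_nat_add of_nat_in_P) (metis PE of_nat_mult of_nat_in_P)

lemma P_0: "0 \<in> P" and P_1: "1 \<in> P"
  using of_nat_in_P[of 0] of_nat_in_P[of 1] by simp_all

lemma P_uminus: "a \<in> P \<Longrightarrow> - a \<in> P"
proof -
  have "of_nat (p - 1) = (- 1 :: 'f)"
    using prime_gt_0_nat[OF prime] by (simp add: of_nat_diff of_nat_p)
  then have "- 1 \<in> P" by (metis of_nat_in_P)
  then show "a \<in> P \<Longrightarrow> - a \<in> P" using P_mult[of "- 1" a] by simp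
qed

lemma P_diff: "a \<in> P \<Longrightarrow> b \<in> P \<Longrightarrow> a - b \<in> P"
  using P_add[of a "- b"] P_uminus[of b] by simp

text \<open>Multiplication by a nonzero a is injective on the finite set \<open>P\<close>, so it
  reaches 1.\<close>

lemma P_inverse: "a \<in> P \<Longrightarrow> inverse a \<in> P"
proof (cases "a = 0")
  case False
  assume a: "a \<in> P"
  have "(*) a ` P = P"
    by (rule endo_inj_surj) (use a P_mult False in \<open>auto simp: inj_on_def\<close>)
  then have "1 \<in> (*) a ` P" using P_1 by simp
  then obtain b where b: "b \<in> P" "1 = a * b" by (rule imageE)
  have "inverse a = b" by (rule inverse_unique) (simp add: b(2)[symmetric])
  then show ?thesis using b(1) by simp
qed (simp add: P_0)

section \<open>Powers of the primitive element as a basis over the prime field\<close>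

definition V :: "nat \<Rightarrow> 'f set" where
  "V n = {(\<Sum>i<n. c i * \<xi> ^ i) |c. \<forall>i. c i \<in> P}"

lemma VI: "u = (\<Sum>i<n. c i * \<xi> ^ i) \<Longrightarrow> (\<And>i. c i \<in> P) \<Longrightarrow> u \<in> V n"
  unfolding V_def by auto

lemma VE:
  assumes "u \<in> V n"
  obtains c where "u = (\<Sum>i<n. c i * \<xi> ^ i)" "\<And>i. c i \<in> P"
  using assms unfolding V_def by auto

lemma V_add: "u \<in> V n \<Longrightarrow> v \<in> V n \<Longrightarrow> u + v \<in> V n"
proof (elim VE)
  fix c d assume "u = (\<Sum>i<n. c i * \<xi> ^ i)" "\<And>i. c i \<in> P"
    "v = (\<Sum>i<n. d i * \<xi> ^ i)" "\<And>i. d i \<in> P"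
  then show "u + v \<in> V n"
    by (intro VI[where c = "\<lambda>i. c i + d i"] P_add) (simp_all add: distrib_right sum.distrib)
qed

lemma V_scale: "a \<in> P \<Longrightarrow> u \<in> V n \<Longrightarrow> a * u \<in> V n"
proof (elim VE)
  fix c assume "a \<in> P" "u = (\<Sum>i<n. c i * \<xi> ^ i)" "\<And>i. c i \<in> P"
  then show "a * u \<in> V n"
    by (intro VI[where c = "\<lambda>i. a * c i"] P_mult) (simp_all add: sum_distrib_left mult.assoc)
qed

lemma power_in_V: "i < n \<Longrightarrow> \<xi> ^ i \<in> V n"
  by (rule VI[where c = "\<lambda>j. if j = i then 1 else 0"])
    (simp_all add: if_distrib[of "\<lambda>x. x * _"] P_0 P_1 cong: if_cong)

lemma card_V: "card (V n) \<le> p ^ n"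
proof -
  have "V n \<subseteq> (\<lambda>c. \<Sum>i<n. c i * \<xi> ^ i) ` ({..<n} \<rightarrow>\<^sub>E P)"
  proof
    fix u assume "u \<in> V n"
    then obtain c where c: "u = (\<Sum>i<n. c i * \<xi> ^ i)" "\<And>i. c i \<in> P" by (rule VE) blast
    then have "u = (\<Sum>i<n. restrict c {..<n} i * \<xi> ^ i)" "restrict c {..<n} \<in> {..<n} \<rightarrow>\<^sub>E P"
      by auto
    then show "u \<in> (\<lambda>c. \<Sum>i<n. c i * \<xi> ^ i) ` ({..<n} \<rightarrow>\<^sub>E P)" by blast
  qed
  then have "card (V n) \<le> card ({..<n} \<rightarrow>\<^sub>E P)"
    by (meson card_image_le card_mono finite le_trans finite_PiE finite_lessThan finite_imageI)
  then show ?thesis by (simp add: card_funcsetE card_P)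
qed

text \<open>The hypothesis makes \<open>V n\<close> closed under multiplication by \<xi>, so it
  contains all powers of \<xi>, and these are all nonzero elements.\<close>

lemma V_eq_UNIV:
  assumes "\<xi> ^ n \<in> V n"
  shows "V n = UNIV"
proof -
  \<comment> \<open>This excludes n = 0, where \<open>V 0\<close> consists of 0 alone.\<close>
  have "\<xi> ^ 0 \<noteq> 0" by simp
  with assms have n: "n > 0" by (cases n) (auto simp: V_def)
  have "\<xi> * u \<in> V n" if "u \<in> V n" for u
  proof -
    obtain c where c: "u = (\<Sum>i<n. c i * \<xi> ^ i)" "\<And>i. c i \<in> P" using \<open>u \<in> V n\<close> by (rule VE) blast
    have "(\<Sum>i\<in>A. c i * \<xi> ^ Suc i) \<in> V n" if "A \<subseteq> {..<n}" for A
      using finite_subset[OF that finite_lessThan] that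
    proof (induction A rule: finite_induct)
      case empty
      then show ?case using V_scale[OF P_0 power_in_V[OF n]] by simp
    next
      case (insert i A)
      have "\<xi> ^ Suc i \<in> V n" using power_in_V[of "Suc i" n] assms insert.prems by (cases "Suc i = n") auto
      then show ?case using insert V_add V_scale[OF c(2)] by simp
    qed
    from this[of "{..<n}"] show ?thesis by (simp add: c(1) sum_distrib_left mult.left_commute)
  qed
  then have pow: "\<xi> ^ k \<in> V n" for k
    using power_in_V[OF n] by (induction k) auto
  have zero: "0 \<in> V n" using V_scale[OF P_0 power_in_V[OF n]] by simp
  have "u \<in> V n" for u
  proof (cases "u = 0")
    case False
    then have "u \<in> range (\<lambda>n::nat. \<xi> ^ n)" by (simp add: primitive)
    then show ?thesis using pow by (elim imageE) simp
  qed (simp add: zero)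
  then show ?thesis by blast
qed

text \<open>For n < r the set \<open>V n\<close> is too small to be the field, so it cannot contain
  \<xi>^n. If two coefficient families had the same sum, the highest index n where they differ would
  yield \<xi>^n in \<open>V n\<close>. The p^r sums are therefore distinct and exhaust the
  field.\<close>

lemma V_r: "V r = UNIV"
proof -
  let ?s = "\<lambda>c. \<Sum>i<r. c i * \<xi> ^ i"
  have small: "\<xi> ^ n \<notin> V n" if "n < r" for n
  proof
    assume "\<xi> ^ n \<in> V n"
    then have "p ^ r \<le> p ^ n" using card_V[of n] V_eq_UNIV[of n] card_UNIV by simp
    then show False using that power_strict_increasing[OF that prime_gt_1_nat[OF prime]] by simp
  qed
  have "inj_on ?s ({..<r} \<rightarrow>\<^sub>E P)"
  proof (rule inj_onI, rule ccontr)
    fix c d assume c: "c \<in> {..<r} \<rightarrow>\<^sub>E P" and d: "d \<in> {..<r} \<rightarrow>\<^sub>E P"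
      and eq: "?s c = ?s d" and ne: "c \<noteq> d"
    let ?B = "{i. i < r \<and> c i \<noteq> d i}"
    have "?B \<noteq> {}" using PiE_ext[OF c d] ne by blast
    define n where "n = Max ?B"
    have n: "n < r" "c n \<noteq> d n" using Max_in[of ?B] \<open>?B \<noteq> {}\<close> by (auto simp: n_def)
    define e where "e i = (if i < r then c i - d i else 0)" for i
    have eP: "e i \<in> P" for i
      using c d P_diff P_0 by (auto simp: e_def PiE_mem)
    have "(\<Sum>i<r. e i * \<xi> ^ i) = 0"
      using eq by (simp add: e_def left_diff_distrib sum_subtractf)
    also have "(\<Sum>i<r. e i * \<xi> ^ i) = (\<Sum>i<Suc n. e i * \<xi> ^ i)"
    proof (rule sum.mono_neutral_right)
      show "\<forall>i\<in>{..<r} - {..<Suc n}. e i * \<xi> ^ i = 0"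
      proof
        fix i assume i: "i \<in> {..<r} - {..<Suc n}"
        have "i \<notin> ?B"
        proof
          assume "i \<in> ?B"
          then have "i \<le> n" unfolding n_def by (intro Max_ge) simp_all
          then show False using i by simp
        qed
        then show "e i * \<xi> ^ i = 0" using i by (simp add: e_def)
      qed
    qed (use n in auto)
    finally have "e n * \<xi> ^ n = - (\<Sum>i<n. e i * \<xi> ^ i)" by (simp add: eq_neg_iff_add_eq_0 add.commute)
    moreover have en: "e n \<noteq> 0" using n by (simp add: e_def)
    ultimately have "\<xi> ^ n = (- inverse (e n)) * (\<Sum>i<n. e i * \<xi> ^ i)"
      by (simp add: field_simps)
    moreover have "(\<Sum>i<n. e i * \<xi> ^ i) \<in> V n" by (rule VI[OF refl eP])
    ultimately have "\<xi> ^ n \<in> V n" using V_scale[OF P_uminus[OF P_inverse[OF eP]]] by metis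
    then show False using small n by blast
  qed
  then have "card (?s ` ({..<r} \<rightarrow>\<^sub>E P)) = card (UNIV :: 'f set)"
    by (simp add: card_image card_funcsetE card_P card_UNIV)
  then have im: "?s ` ({..<r} \<rightarrow>\<^sub>E P) = UNIV"
    by (intro card_subset_eq) auto
  have "u \<in> V r" for u
  proof -
    obtain c where c: "c \<in> {..<r} \<rightarrow>\<^sub>E P" "u = ?s c" using im by blast
    \<comment> \<open>Beyond r the family c is \<open>undefined\<close>, which need not lie in
      \<open>P\<close>, so it is replaced by 0 there.\<close>
    show ?thesis
      by (rule VI[where c = "\<lambda>i. if i < r then c i else 0"]) (use c P_0 in \<open>auto simp: PiE_mem\<close>)
  qed
  then show ?thesis by blast
qed

text \<open>Coefficients in the prime field are natural numbers, so closure under addition is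
  enough. This carries the relations for the generators g_i over to all of E.\<close>

lemma additive_closure:
  assumes zero: "0 \<in> B" and add: "\<And>a b. a \<in> B \<Longrightarrow> b \<in> B \<Longrightarrow> a + b \<in> B"
    and gen: "\<And>i. i < r \<Longrightarrow> \<xi> ^ i \<in> B"
  shows "B = UNIV"
proof -
  have mult: "of_nat n * b \<in> B" if "b \<in> B" for n b
    by (induction n) (simp_all add: zero add that distrib_right)
  have "u \<in> B" for u
  proof -
    have "u \<in> V r" by (simp add: V_r)
    then obtain c where c: "u = (\<Sum>i<r. c i * \<xi> ^ i)" "\<And>i. c i \<in> P" by (rule VE) blast
    have "(\<Sum>i\<in>A. c i * \<xi> ^ i) \<in> B" if "A \<subseteq> {..<r}" for A
      using finite_subset[OF that finite_lessThan] that
    proof (induction A rule: finite_induct)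
      case (insert i A)
      obtain n where n: "c i = of_nat n" using c(2) by (rule PE)
      then show ?case using insert mult[OF gen] add by auto
    qed (simp add: zero)
    then show ?thesis by (simp add: c(1))
  qed
  then show ?thesis by blast
qed

section \<open>The complement \<Xi> of the prime field\<close>

lemma XiI: "u = (\<Sum>i\<in>{1..r-1}. c i * \<xi> ^ i) \<Longrightarrow> (\<And>i. c i \<in> P) \<Longrightarrow> u \<in> Xi \<xi> r"
  unfolding Xi_def P_def by auto

lemma XiE:
  assumes "u \<in> Xi \<xi> r"
  obtains c where "u = (\<Sum>i\<in>{1..r-1}. c i * \<xi> ^ i)" "\<And>i. c i \<in> P"
  using assms unfolding Xi_def P_def by auto

lemma Xi_diff: "\<zeta> \<in> Xi \<xi> r \<Longrightarrow> \<eta> \<in> Xi \<xi> r \<Longrightarrow> \<zeta> - \<eta> \<in> Xi \<xi> r"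
proof (elim XiE)
  fix c d assume "\<zeta> = (\<Sum>i\<in>{1..r-1}. c i * \<xi> ^ i)" "\<And>i. c i \<in> P"
    "\<eta> = (\<Sum>i\<in>{1..r-1}. d i * \<xi> ^ i)" "\<And>i. d i \<in> P"
  then show "\<zeta> - \<eta> \<in> Xi \<xi> r"
    by (intro XiI[where c = "\<lambda>i. c i - d i"] P_diff) (simp_all add: left_diff_distrib sum_subtractf)
qed

lemma Xi_span: "\<exists>n. \<exists>\<eta>\<in>Xi \<xi> r. b = of_nat n + \<eta>"
proof -
  have "b \<in> V r" by (simp add: V_r)
  then obtain c where c: "b = (\<Sum>i<r. c i * \<xi> ^ i)" "\<And>i. c i \<in> P" by (rule VE) blast
  obtain n where n: "c 0 = of_nat n" using c(2) by (rule PE)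
  have "{..<r} = insert 0 {1..r-1}" using r by auto
  then have "b = of_nat n + (\<Sum>i\<in>{1..r-1}. c i * \<xi> ^ i)" by (simp add: c(1) n)
  moreover have "(\<Sum>i\<in>{1..r-1}. c i * \<xi> ^ i) \<in> Xi \<xi> r" by (rule XiI[OF refl c(2)])
  ultimately show ?thesis by blast
qed

text \<open>Counting coefficient families bounds the size of \<Xi> from above; the surjection (a, b)
  |-> a + b from \<open>P\<close> \<times> \<Xi> onto the field bounds it from below.\<close>

lemma card_Xi: "p * card (Xi \<xi> r) = card (UNIV :: 'f set)"
proof (rule antisym)
  have "Xi \<xi> r \<subseteq> (\<lambda>c. \<Sum>i\<in>{1..r-1}. c i * \<xi> ^ i) ` ({1..r-1} \<rightarrow>\<^sub>E P)"
  proof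
    fix u assume "u \<in> Xi \<xi> r"
    then obtain c where c: "u = (\<Sum>i\<in>{1..r-1}. c i * \<xi> ^ i)" "\<And>i. c i \<in> P" by (rule XiE) blast
    then have "u = (\<Sum>i\<in>{1..r-1}. restrict c {1..r-1} i * \<xi> ^ i)" "restrict c {1..r-1} \<in> {1..r-1} \<rightarrow>\<^sub>E P"
      by auto
    then show "u \<in> (\<lambda>c. \<Sum>i\<in>{1..r-1}. c i * \<xi> ^ i) ` ({1..r-1} \<rightarrow>\<^sub>E P)" by blast
  qed
  then have "card (Xi \<xi> r) \<le> card ({1..r-1} \<rightarrow>\<^sub>E P)"
    by (meson card_image_le card_mono finite le_trans finite_PiE finite_atLeastAtMost finite_imageI)
  then have "card (Xi \<xi> r) \<le> p ^ (r - 1)" by (simp add: card_funcsetE card_P)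
  then show "p * card (Xi \<xi> r) \<le> card (UNIV :: 'f set)"
    unfolding card_UNIV power_eq_if[of p r] using r by simp
  have "UNIV = (\<lambda>(a, b). a + b) ` (P \<times> Xi \<xi> r)"
  proof (intro equalityI subsetI)
    fix b :: 'f
    obtain n \<eta> where "b = of_nat n + \<eta>" "\<eta> \<in> Xi \<xi> r" using Xi_span by blast
    then show "b \<in> (\<lambda>(a, b). a + b) ` (P \<times> Xi \<xi> r)"
      using of_nat_in_P[of n] by (intro image_eqI[of _ _ "(of_nat n, \<eta>)"]) auto
  qed auto
  then have "card (UNIV :: 'f set) \<le> card (P \<times> Xi \<xi> r)"
    using card_image_le[of "P \<times> Xi \<xi> r" "\<lambda>(a, b). a + b"] by simp
  then show "card (UNIV :: 'f set) \<le> p * card (Xi \<xi> r)"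
    by (simp add: card_cartesian_product card_P)
qed

end

section \<open>The quotient algebra\<close>

lemma smash_product_simps:
  "carrier smash_product = UNIV"
  "coeffs F \<otimes>\<^bsub>smash_product\<^esub> coeffs G = coeffs (F * G)"
  "coeffs F \<oplus>\<^bsub>smash_product\<^esub> coeffs G = coeffs (F + G)"
  "\<one>\<^bsub>smash_product\<^esub> = coeffs 1" "\<zero>\<^bsub>smash_product\<^esub> = coeffs 0"
  by (simp_all add: smash_product_def times_smash_def plus_smash_def one_smash_def zero_smash_def)

lemma ring_smash_product: "ring (smash_product :: ('f::{finite, field} \<Rightarrow> 'f free_algebra) ring)"
  (is "ring ?R")
proof -
  have cases: "\<exists>F. x = coeffs F" for x :: "'f \<Rightarrow> 'f free_algebra"
    by (rule exI[of _ "Smash x"]) simp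
  show ?thesis
  proof (rule ringI)
    show "abelian_group ?R"
    proof (rule abelian_groupI)
      fix x y z :: "'f \<Rightarrow> 'f free_algebra"
      obtain F G K where xyz: "x = coeffs F" "y = coeffs G" "z = coeffs K" using cases by metis
      show "x \<oplus>\<^bsub>?R\<^esub> y \<oplus>\<^bsub>?R\<^esub> z = x \<oplus>\<^bsub>?R\<^esub> (y \<oplus>\<^bsub>?R\<^esub> z)" "x \<oplus>\<^bsub>?R\<^esub> y = y \<oplus>\<^bsub>?R\<^esub> x" "\<zero>\<^bsub>?R\<^esub> \<oplus>\<^bsub>?R\<^esub> x = x"
        unfolding xyz smash_product_simps by (simp_all only: ac_simps add_0_left add_0_right)
      show "\<exists>y\<in>carrier ?R. y \<oplus>\<^bsub>?R\<^esub> x = \<zero>\<^bsub>?R\<^esub>"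
        unfolding xyz smash_product_simps by (intro bexI[of _ "coeffs (- F)"]) (simp_all add: smash_product_simps)
    qed (simp_all add: smash_product_simps)
    show "Group.monoid ?R"
    proof (rule monoidI)
      fix x y z :: "'f \<Rightarrow> 'f free_algebra"
      obtain F G K where xyz: "x = coeffs F" "y = coeffs G" "z = coeffs K" using cases by metis
      show "x \<otimes>\<^bsub>?R\<^esub> y \<otimes>\<^bsub>?R\<^esub> z = x \<otimes>\<^bsub>?R\<^esub> (y \<otimes>\<^bsub>?R\<^esub> z)" "\<one>\<^bsub>?R\<^esub> \<otimes>\<^bsub>?R\<^esub> x = x" "x \<otimes>\<^bsub>?R\<^esub> \<one>\<^bsub>?R\<^esub> = x"
        unfolding xyz smash_product_simps by (simp_all only: mult.assoc mult_1_left mult_1_right)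
    qed (simp_all add: smash_product_simps)
  next
    fix x y z :: "'f \<Rightarrow> 'f free_algebra"
    obtain F G K where xyz: "x = coeffs F" "y = coeffs G" "z = coeffs K" using cases by metis
    show "(x \<oplus>\<^bsub>?R\<^esub> y) \<otimes>\<^bsub>?R\<^esub> z = x \<otimes>\<^bsub>?R\<^esub> z \<oplus>\<^bsub>?R\<^esub> y \<otimes>\<^bsub>?R\<^esub> z" "z \<otimes>\<^bsub>?R\<^esub> (x \<oplus>\<^bsub>?R\<^esub> y) = z \<otimes>\<^bsub>?R\<^esub> x \<oplus>\<^bsub>?R\<^esub> z \<otimes>\<^bsub>?R\<^esub> y"
      unfolding xyz smash_product_simps by (simp_all only: distrib_left distrib_right)
  qed
qed

interpretation smash_product: ring smash_product
  by (rule ring_smash_product)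

lemma smash_product_uminus: "\<ominus>\<^bsub>smash_product\<^esub> coeffs G = coeffs (- G)"
  by (rule smash_product.minus_equality) (simp_all only: smash_product_simps UNIV_I, simp)

lemma smash_product_minus: "coeffs F \<ominus>\<^bsub>smash_product\<^esub> coeffs G = coeffs (F - G)"
  by (simp add: a_minus_def smash_product_simps smash_product_uminus)

lemma H_ideal_eq:
  "(H_ideal :: ('f::{finite, field} \<Rightarrow> 'f free_algebra) set) = Idl\<^bsub>smash_product\<^esub> {coeffs relator}"
proof -
  have "smash_of_free (free_x * free_y - free_y * free_x) = coeffs (sx * sy - sy * sx :: 'f smash)"
    by (simp only: sfree_mult[symmetric] sfree_diff[symmetric]) (simp add: sfree_def)
  moreover have "smash_of_group 1 = coeffs (sgroup 1 :: 'f smash)" by (simp add: sgroup_def)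
  ultimately show ?thesis by (simp only: H_ideal_def smash_product_minus relator_def)
qed

lemma ideal_H_ideal: "ideal H_ideal smash_product"
  unfolding H_ideal_eq by (rule smash_product.genideal_ideal) (simp add: smash_product_simps)

lemma relator_in_H_ideal: "coeffs relator \<in> H_ideal"
  unfolding H_ideal_eq by (rule smash_product.genideal_self') (simp add: smash_product_simps)

interpretation H_alg: ring H_alg
  unfolding H_alg_def by (rule ideal.quotient_is_ring[OF ideal_H_ideal])

text \<open>By \<open>q_cases\<close> every element of the quotient has this form, so calculations
  in \<open>H_alg\<close> are carried out on representatives.\<close>

definition q :: "'f::{finite, field} smash \<Rightarrow> 'f H_elem" where
  "q F = H_ideal +>\<^bsub>smash_product\<^esub> coeffs F"

lemma H_generators:
  "H_const c = q (sconst c)" "H_x = q sx" "H_y = q sy" "H_group a = q (sgroup a)"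
  by (simp_all add: q_def H_const_def H_x_def H_y_def H_group_def sfree_def sgroup_def)

lemma
  fixes F G :: "'f::{finite, field} smash"
  shows q_carrier [simp]: "q F \<in> carrier H_alg"
  and q_mult: "q (F * G) = q F \<otimes>\<^bsub>H_alg\<^esub> q G"
  and q_add: "q (F + G) = q F \<oplus>\<^bsub>H_alg\<^esub> q G"
  and q_1: "q (1 :: 'f smash) = \<one>\<^bsub>H_alg\<^esub>"
proof -
  have hom: "(+>\<^bsub>smash_product\<^esub>) H_ideal \<in> ring_hom smash_product (H_alg :: 'f H_elem ring)"
    unfolding H_alg_def by (rule ideal.rcos_ring_hom[OF ideal_H_ideal])
  have c: "x \<in> carrier smash_product" for x :: "'f \<Rightarrow> 'f free_algebra"
    by (simp add: smash_product_simps)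
  show "q F \<in> carrier H_alg" unfolding q_def by (rule ring_hom_closed[OF hom c])
  show "q (F * G) = q F \<otimes>\<^bsub>H_alg\<^esub> q G"
    unfolding q_def smash_product_simps(2)[symmetric] by (rule ring_hom_mult[OF hom c c])
  show "q (F + G) = q F \<oplus>\<^bsub>H_alg\<^esub> q G"
    unfolding q_def smash_product_simps(3)[symmetric] by (rule ring_hom_add[OF hom c c])
  show "q (1 :: 'f smash) = \<one>\<^bsub>H_alg\<^esub>"
    unfolding q_def smash_product_simps(4)[symmetric] by (rule ring_hom_one[OF hom])
qed

lemma q_0: "q (0 :: 'f::{finite, field} smash) = \<zero>\<^bsub>H_alg\<^esub>"
proof -
  have "q 0 \<oplus>\<^bsub>H_alg\<^esub> q 0 = q (0 :: 'f smash) \<oplus>\<^bsub>H_alg\<^esub> \<zero>\<^bsub>H_alg\<^esub>"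
    using q_add[of 0 0] by simp
  then show ?thesis
    by (simp only: H_alg.add.l_cancel q_carrier H_alg.zero_closed)
qed

lemma q_minus: "q (- F) = \<ominus>\<^bsub>H_alg\<^esub> q F"
  by (rule H_alg.minus_equality[symmetric]) (simp_all add: q_add[symmetric] q_0)

lemma q_diff: "q (F - G) = q F \<ominus>\<^bsub>H_alg\<^esub> q G"
  using q_add[of F "- G"] by (simp add: a_minus_def q_minus)

lemma q_power: "q (F ^ n) = q F [^]\<^bsub>H_alg\<^esub> n"
  by (induction n) (simp_all add: q_1 q_mult power_Suc2 del: power_Suc)

lemma q_cases:
  assumes "u \<in> carrier H_alg"
  obtains F where "u = q F"
proof -
  from assms obtain x where "u = H_ideal +>\<^bsub>smash_product\<^esub> x"
    unfolding H_alg_def FactRing_def A_RCOSETS_def' by auto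
  then have "u = q (Smash x)" by (simp add: q_def)
  then show ?thesis by (rule that)
qed

lemma q_eq_iff: "q F = q G \<longleftrightarrow> coeffs (F - G) \<in> H_ideal"
  using smash_product.quotient_eq_iff_same_a_r_cos[OF ideal_H_ideal, of "coeffs F" "coeffs G"]
  by (simp add: q_def smash_product_minus smash_product_simps)

lemma q_relator: "q (relator * F) = q 0"
  using ideal.I_r_closed[OF ideal_H_ideal relator_in_H_ideal, of "coeffs F"]
  by (simp add: q_eq_iff smash_product_simps)

lemma q_sum:
  assumes "finite I"
  shows "q (\<Sum>i\<in>I. F i) = (\<Oplus>\<^bsub>H_alg\<^esub>i\<in>I. q (F i))"
  using assms by (induction I rule: finite_induct) (simp_all add: q_0 q_add Pi_def)

lemma q_prod_list: "q (prod_list Fs) = list_product H_alg (map q Fs)"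
  by (induction Fs) (simp_all add: list_product_def q_1 q_mult)

lemma C_elem_eq: "C_elem p \<zeta>s = q (C_smash p \<zeta>s)"
  by (simp only: C_elem_def C_smash_def q_prod_list map_map comp_def q_diff q_mult H_generators)

text \<open>The kernel of \<open>\<rho>\<close> is a two-sided ideal containing the relator, hence
  containing \<open>H_ideal\<close>; so the orbit map is well defined on H.\<close>

lemma (in polynomial_model) q_eq_psi: "q F = q G \<Longrightarrow> \<psi> F = \<psi> G"
proof -
  let ?K = "{x. \<rho> (Smash x) = 0}"
  have Smash: "Smash (coeffs F) = F" for F :: "'f smash" by (simp add: coeffs_inverse)
  have "ideal ?K smash_product"
  proof (rule idealI[OF ring_smash_product])
    show "subgroup ?K (add_monoid smash_product)"
    proof (rule smash_product.add.subgroupI)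
      show "?K \<noteq> {}" using rho.sev_0 Smash by (metis (mono_tags, lifting) empty_iff mem_Collect_eq)
      fix x y assume xy: "x \<in> ?K" "y \<in> ?K"
      then show "\<ominus>\<^bsub>smash_product\<^esub> x \<in> ?K"
        using smash_product_uminus[of "Smash x"] by (simp add: Smash rho.sev_minus)
      show "x \<oplus>\<^bsub>smash_product\<^esub> y \<in> ?K"
        using xy smash_product_simps(3)[of "Smash x" "Smash y"] by (simp add: Smash rho.sev_add)
    qed (simp add: smash_product_simps)
    fix x y assume x: "x \<in> ?K"
    show "y \<otimes>\<^bsub>smash_product\<^esub> x \<in> ?K" "x \<otimes>\<^bsub>smash_product\<^esub> y \<in> ?K"
      using x smash_product_simps(2)[of "Smash x" "Smash y"] smash_product_simps(2)[of "Smash y" "Smash x"]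
      by (simp_all add: Smash rho.sev_mult)
  qed
  then have "H_ideal \<subseteq> ?K"
    unfolding H_ideal_eq by (rule smash_product.genideal_minimal) (simp add: Smash rho_relator)
  moreover assume "q F = q G"
  ultimately have "\<rho> (F - G) = 0" using Smash[of "F - G"] by (auto simp: q_eq_iff)
  then show ?thesis by (simp add: rho.sev_diff \<psi>_def)
qed

section \<open>The module Delta\<close>

locale delta_module = polynomial_model p \<alpha> + primitive_element p r \<xi>
  for p r :: nat and \<xi> :: "'f::{finite, field}" and \<alpha> :: "'f alg_closure"
begin

abbreviation L0 :: "'f H_elem set" where "L0 \<equiv> Delta_ideal \<xi> r \<alpha>"
abbreviation \<Delta> :: "('f H_elem, 'f H_elem set) module" where "\<Delta> \<equiv> Delta \<xi> r \<alpha>"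

definition gens :: "'f smash \<Rightarrow> (nat \<Rightarrow> 'f smash) \<Rightarrow> 'f smash" where
  "gens U W = U * (sx - sconst \<alpha>) + (\<Sum>i\<in>{1..r}. W i * (sgroup (\<xi> ^ (i - 1)) - 1))"

lemma q_gens: "q (gens U W) = q U \<otimes>\<^bsub>H_alg\<^esub> (H_x \<ominus>\<^bsub>H_alg\<^esub> H_const \<alpha>) \<oplus>\<^bsub>H_alg\<^esub>
       (\<Oplus>\<^bsub>H_alg\<^esub>i\<in>{1..r}. q (W i) \<otimes>\<^bsub>H_alg\<^esub> (H_group (\<xi> ^ (i - 1)) \<ominus>\<^bsub>H_alg\<^esub> \<one>\<^bsub>H_alg\<^esub>))"
  by (simp only: gens_def q_add q_mult q_diff q_1 H_generators q_sum[OF finite_atLeastAtMost])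

lemma Delta_ideal_eq: "L0 = {q (gens U W) |U W. True}"
proof (intro equalityI subsetI)
  fix a assume "a \<in> L0"
  then obtain u v where a: "a = u \<otimes>\<^bsub>H_alg\<^esub> (H_x \<ominus>\<^bsub>H_alg\<^esub> H_const \<alpha>) \<oplus>\<^bsub>H_alg\<^esub>
       (\<Oplus>\<^bsub>H_alg\<^esub>i\<in>{1..r}. v i \<otimes>\<^bsub>H_alg\<^esub> (H_group (\<xi> ^ (i - 1)) \<ominus>\<^bsub>H_alg\<^esub> \<one>\<^bsub>H_alg\<^esub>))"
    and u: "u \<in> carrier H_alg" and v: "\<forall>i\<in>{1..r}. v i \<in> carrier H_alg"
    unfolding Delta_ideal_def by blast
  obtain U where U: "u = q U" using u by (rule q_cases)
  have "\<forall>i\<in>{1..r}. \<exists>W. v i = q W" using v by (meson q_cases)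
  then obtain W where W: "\<And>i. i \<in> {1..r} \<Longrightarrow> v i = q (W i)" by metis
  have "a = q (gens U W)"
    unfolding q_gens a U
    by (intro arg_cong2[where f = "add H_alg"] refl H_alg.finsum_cong')
      (auto simp: W H_generators q_1[symmetric] q_diff[symmetric] q_mult[symmetric] simp del: One_nat_def)
  then show "a \<in> {q (gens U W) |U W. True}" by blast
next
  fix a assume "a \<in> {q (gens U W) |U W. True}"
  then obtain U W where "a = q (gens U W)" by blast
  then show "a \<in> L0"
    unfolding Delta_ideal_def q_gens by (intro CollectI exI[of _ "q U"] exI[of _ "\<lambda>i. q (W i)"]) simp
qed

definition D :: "'f smash set" where "D = {F. q F \<in> L0}"

lemma D_iff: "F \<in> D \<longleftrightarrow> (\<exists>U W. q F = q (gens U W))"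
  by (auto simp: D_def Delta_ideal_eq)

lemma gens_mult: "F * gens U W = gens (F * U) (\<lambda>i. F * W i)"
  by (simp add: gens_def distrib_left sum_distrib_left mult.assoc)

lemma gens_add: "gens U W + gens U' W' = gens (U + U') (\<lambda>i. W i + W' i)"
  by (simp add: gens_def distrib_right sum.distrib ac_simps)

lemma gens_0: "gens 0 (\<lambda>i. 0) = 0"
  by (simp add: gens_def)

lemma left_ideal_D: "left_ideal D"
proof -
  have "F + G \<in> D" if "F \<in> D" "G \<in> D" for F G
    using that unfolding D_iff q_add by (metis gens_add q_add)
  moreover have "F * G \<in> D" if "G \<in> D" for F G
    using that unfolding D_iff q_mult by (metis gens_mult q_mult)
  moreover have "0 \<in> D" unfolding D_iff by (metis gens_0)
  ultimately show ?thesis by (simp add: left_ideal_def)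
qed

lemma group_in_left_ideal:
  assumes L: "left_ideal L" and gen: "\<And>i. i < r \<Longrightarrow> sgroup (\<xi> ^ i) - 1 \<in> L"
  shows "sgroup a - 1 \<in> L"
proof -
  have "{a. sgroup a - 1 \<in> L} = UNIV"
  proof (rule additive_closure)
    show "0 \<in> {a. sgroup a - 1 \<in> L}" using left_idealD(1)[OF L] by simp
    fix a b assume "a \<in> {a. sgroup a - 1 \<in> L}" "b \<in> {a. sgroup a - 1 \<in> L}"
    then have "sgroup a * (sgroup b - 1) + (sgroup a - 1) \<in> L"
      using left_idealD(2,3)[OF L] by simp
    then show "a + b \<in> {a. sgroup a - 1 \<in> L}" by (simp add: sgroup_add right_diff_distrib)
  qed (use gen in simp)
  then show ?thesis by blast
qed

lemma admissible_D: "admissible D"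
proof -
  have rel: "relator * F \<in> D" for F
    unfolding D_iff q_relator by (metis gens_0)
  have x: "sx - sconst \<alpha> \<in> D"
  proof -
    have "sx - sconst \<alpha> = gens 1 (\<lambda>i. 0)" by (simp add: gens_def)
    then show ?thesis unfolding D_iff by metis
  qed
  have "sgroup (\<xi> ^ i) - 1 \<in> D" if "i < r" for i
  proof -
    \<comment> \<open>The index is shifted because the generator with index j belongs to
      \<xi>^(j-1).\<close>
    have "gens 0 (\<lambda>j. if j = Suc i then 1 else 0) =
        (\<Sum>j\<in>{1..r}. if j = Suc i then sgroup (\<xi> ^ i) - 1 else 0)"
      unfolding gens_def by (simp add: if_distrib[of "\<lambda>x. x * _"] cong: if_cong)
    also have "\<dots> = sgroup (\<xi> ^ i) - 1" using that by simp
    finally show ?thesis unfolding D_iff by metis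
  qed
  then show ?thesis
    using left_ideal_D rel x group_in_left_ideal[OF left_ideal_D] by (simp add: admissible_def)
qed

text \<open>Membership in \<open>D\<close> is known only up to relations of H. The resulting error
  has image 0 under \<open>\<psi>\<close>, so it lies in L by \<open>psi_kernel\<close>.\<close>

lemma D_minimal:
  assumes L: "admissible L"
  shows "D \<subseteq> L"
proof
  fix F assume "F \<in> D"
  then obtain U W where F: "q F = q (gens U W)" unfolding D_iff by blast
  have id: "left_ideal L" using L by (simp add: admissible_def)
  have "(\<Sum>i\<in>I. W i * (sgroup (\<xi> ^ (i - 1)) - 1)) \<in> L" for I
    using L left_idealD(1,2,3)[OF id]
    by (induction I rule: infinite_finite_induct) (simp_all add: admissible_def)
  then have "gens U W \<in> L"
    using L left_idealD(2,3)[OF id] by (simp add: gens_def admissible_def)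
  moreover have "F - gens U W \<in> L"
    using psi_kernel[OF L, of "F - gens U W"] q_eq_psi[OF F] by (simp add: psi_diff)
  ultimately have "F - gens U W + gens U W \<in> L" using left_idealD(2)[OF id] by blast
  then show "F \<in> L" by simp
qed

section \<open>Cosets in Delta, and submodules as admissible left ideals\<close>

definition pr :: "'f smash \<Rightarrow> 'f H_elem set" where
  "pr F = L0 +>\<^bsub>H_alg\<^esub> q F"

lemma pr_eq: "pr F = q ` {G. G - F \<in> D}"
proof (intro equalityI subsetI)
  fix a assume "a \<in> pr F"
  then obtain d where d: "d \<in> L0" "a = d \<oplus>\<^bsub>H_alg\<^esub> q F" unfolding pr_def a_r_coset_def' by blast
  then obtain E where "d = q E" "E \<in> D" unfolding Delta_ideal_eq D_iff by blast
  then show "a \<in> q ` {G. G - F \<in> D}" using d by (intro image_eqI[of _ _ "E + F"]) (simp_all add: q_add)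
next
  fix a assume "a \<in> q ` {G. G - F \<in> D}"
  then obtain G where G: "a = q G" "G - F \<in> D" by blast
  have "a = q (G - F) \<oplus>\<^bsub>H_alg\<^esub> q F" by (simp add: G q_add[symmetric])
  then show "a \<in> pr F" unfolding pr_def a_r_coset_def' using G(2) by (auto simp: D_def)
qed

lemma pr_eq_iff: "pr F = pr G \<longleftrightarrow> F - G \<in> D"
proof
  assume eq: "pr F = pr G"
  have "q F \<in> pr F" unfolding pr_eq using left_idealD(1)[OF left_ideal_D] by (intro imageI) simp
  then have "q F \<in> q ` {K. K - G \<in> D}" unfolding eq by (simp only: pr_eq)
  then obtain F' where F': "q F = q F'" "F' - G \<in> D" by (elim imageE) simp
  have "F - F' \<in> D" using psi_kernel[OF admissible_D] q_eq_psi[OF F'(1)] by (simp add: psi_diff)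
  from left_idealD(2)[OF left_ideal_D this F'(2)] show "F - G \<in> D" by simp
next
  assume FG: "F - G \<in> D"
  have "K - F \<in> D \<longleftrightarrow> K - G \<in> D" for K
    using left_idealD(2)[OF left_ideal_D _ FG, of "K - F"] left_idealD(5)[OF left_ideal_D _ FG, of "K - G"]
    by auto
  then show "pr F = pr G" by (simp add: pr_eq)
qed

lemma Delta_carrier: "carrier \<Delta> = range pr"
proof -
  have "carrier \<Delta> = {L0 +>\<^bsub>H_alg\<^esub> a |a. a \<in> carrier H_alg}"
    by (auto simp: Delta_def left_quotient_def A_RCOSETS_def')
  also have "\<dots> = range pr" unfolding pr_def by (auto elim: q_cases)
  finally show ?thesis .
qed

lemma Delta_add: "pr F \<oplus>\<^bsub>\<Delta>\<^esub> pr G = pr (F + G)"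
proof -
  have "pr F \<oplus>\<^bsub>\<Delta>\<^esub> pr G = pr F <+>\<^bsub>H_alg\<^esub> pr G"
    by (simp add: Delta_def left_quotient_def)
  also have "\<dots> = {q A \<oplus>\<^bsub>H_alg\<^esub> q B |A B. A - F \<in> D \<and> B - G \<in> D}"
    unfolding set_add_def' pr_eq by blast
  also have "\<dots> = q ` {K. K - (F + G) \<in> D}"
  proof (intro equalityI subsetI)
    fix a assume "a \<in> {q A \<oplus>\<^bsub>H_alg\<^esub> q B |A B. A - F \<in> D \<and> B - G \<in> D}"
    then obtain A B where AB: "a = q (A + B)" "A - F \<in> D" "B - G \<in> D" by (auto simp: q_add)
    from left_idealD(2)[OF left_ideal_D AB(2,3)] have "A + B - (F + G) \<in> D" by (simp add: algebra_simps)
    then show "a \<in> q ` {K. K - (F + G) \<in> D}" using AB(1) by blast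
  next
    fix a assume "a \<in> q ` {K. K - (F + G) \<in> D}"
    then obtain K where K: "a = q K" "K - (F + G) \<in> D" by blast
    have "a = q F \<oplus>\<^bsub>H_alg\<^esub> q (K - F)" by (simp add: K q_add[symmetric])
    moreover have "F - F \<in> D" "K - F - G \<in> D"
      using K(2) left_idealD(1)[OF left_ideal_D] by (simp_all add: algebra_simps)
    ultimately show "a \<in> {q A \<oplus>\<^bsub>H_alg\<^esub> q B |A B. A - F \<in> D \<and> B - G \<in> D}" by blast
  qed
  finally show ?thesis by (simp only: pr_eq)
qed

lemma Delta_zero: "\<zero>\<^bsub>\<Delta>\<^esub> = pr 0"
proof -
  have "L0 = pr 0"
    unfolding pr_eq
  proof (intro equalityI subsetI)
    fix a assume "a \<in> L0"
    then show "a \<in> q ` {G. G - 0 \<in> D}" by (auto simp: Delta_ideal_eq D_iff)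
  qed (auto simp: D_def)
  then show ?thesis by (simp add: Delta_def left_quotient_def)
qed

text \<open>The union in the definition of the scalar product runs over all representatives of the
  coset; they give the same coset because \<open>D\<close> is a left ideal.\<close>

lemma Delta_smult: "q A \<odot>\<^bsub>\<Delta>\<^esub> pr F = pr (A * F)"
proof -
  have "q A \<odot>\<^bsub>\<Delta>\<^esub> pr F = (\<Union>u\<in>pr F. L0 +>\<^bsub>H_alg\<^esub> (q A \<otimes>\<^bsub>H_alg\<^esub> u))"
    by (simp add: Delta_def left_quotient_def)
  also have "\<dots> = (\<Union>G\<in>{G. G - F \<in> D}. pr (A * G))"
    unfolding pr_eq[of F] by (simp add: pr_def q_mult)
  also have "\<dots> = (\<Union>G\<in>{G. G - F \<in> D}. pr (A * F))"
  proof (rule SUP_cong)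
    fix G assume "G \<in> {G. G - F \<in> D}"
    then have "A * G - A * F \<in> D"
      using left_idealD(3)[OF left_ideal_D, of "G - F" A] by (simp add: right_diff_distrib)
    then show "pr (A * G) = pr (A * F)" by (simp only: pr_eq_iff)
  qed simp
  also have "\<dots> = pr (A * F)"
  proof -
    have "F \<in> {G. G - F \<in> D}" using left_idealD(1)[OF left_ideal_D] by simp
    then show ?thesis by blast
  qed
  finally show ?thesis .
qed

lemma submodule_preimage:
  assumes "submodule N H_alg \<Delta>"
  shows "admissible {F. pr F \<in> N}" "N = pr ` {F. pr F \<in> N}"
proof -
  interpret N: submodule N H_alg \<Delta> by (rule assms)
  have sub: "N \<subseteq> range pr" using N.subset by (simp add: Delta_carrier)
  have zero: "pr 0 \<in> N" using N.one_closed by (simp add: Delta_zero)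
  have add: "pr (F + G) \<in> N" if "pr F \<in> N" "pr G \<in> N" for F G
    using N.m_closed[OF that] by (simp add: Delta_add)
  have mult: "pr (A * F) \<in> N" if "pr F \<in> N" for A F
    using N.smult_closed[OF q_carrier that, of A] by (simp add: Delta_smult)
  have D: "pr F \<in> N" if "F \<in> D" for F
    using zero pr_eq_iff[of F 0] that by simp
  show "admissible {F. pr F \<in> N}"
    using admissible_D zero add mult D by (simp add: admissible_def left_ideal_def)
  show "N = pr ` {F. pr F \<in> N}" using sub by blast
qed

text \<open>Together with \<open>submodule_preimage\<close> this is a bijection between submodules
  of Delta and admissible left ideals. The second claim rests on \<open>D_minimal\<close>.\<close>

lemma submodule_image:
  assumes L: "admissible L"
  shows "submodule (pr ` L) H_alg \<Delta>" "{F. pr F \<in> pr ` L} = L"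
proof -
  have id: "left_ideal L" using L by (simp add: admissible_def)
  \<comment> \<open>The inverse is a definite description, so its uniqueness has to be shown as
    well.\<close>
  have inv: "inv\<^bsub>add_monoid \<Delta>\<^esub> (pr F) = pr (- F)" for F
    unfolding m_inv_def
  proof (rule the_equality)
    fix y assume "y \<in> carrier (add_monoid \<Delta>) \<and> pr F \<otimes>\<^bsub>add_monoid \<Delta>\<^esub> y = \<one>\<^bsub>add_monoid \<Delta>\<^esub> \<and>
      y \<otimes>\<^bsub>add_monoid \<Delta>\<^esub> pr F = \<one>\<^bsub>add_monoid \<Delta>\<^esub>"
    then obtain G where "y = pr G" "pr (F + G) = pr 0" by (auto simp: Delta_carrier Delta_add Delta_zero)
    then show "y = pr (- F)" by (simp add: pr_eq_iff add.commute)
  qed (simp add: Delta_carrier Delta_add Delta_zero)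
  show "submodule (pr ` L) H_alg \<Delta>"
  proof (intro submodule.intro subgroup.intro submodule_axioms.intro)
    show "pr ` L \<subseteq> carrier (add_monoid \<Delta>)" by (auto simp: Delta_carrier)
    show "\<one>\<^bsub>add_monoid \<Delta>\<^esub> \<in> pr ` L" using left_idealD(1)[OF id] by (simp add: Delta_zero)
    show "x \<otimes>\<^bsub>add_monoid \<Delta>\<^esub> y \<in> pr ` L" if "x \<in> pr ` L" "y \<in> pr ` L" for x y
      using that left_idealD(2)[OF id] by (auto simp: Delta_add)
    show "inv\<^bsub>add_monoid \<Delta>\<^esub> x \<in> pr ` L" if "x \<in> pr ` L" for x
      using that left_idealD(4)[OF id] by (auto simp: inv)
    show "a \<odot>\<^bsub>\<Delta>\<^esub> x \<in> pr ` L" if "a \<in> carrier H_alg" "x \<in> pr ` L" for a x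
      using that left_idealD(3)[OF id] by (auto simp: Delta_smult elim!: q_cases)
  qed
  show "{F. pr F \<in> pr ` L} = L"
  proof (intro equalityI subsetI)
    fix F assume "F \<in> {F. pr F \<in> pr ` L}"
    then obtain G where G: "pr F = pr G" "G \<in> L" by blast
    then have "F - G \<in> L" using D_minimal[OF L] by (auto simp: pr_eq_iff)
    from left_idealD(2)[OF id this G(2)] show "F \<in> L" by simp
  qed blast
qed

lemma C_maximal:
  assumes \<zeta>s: "distinct \<zeta>s" "set \<zeta>s = Xi \<xi> r"
  shows "maximal_submodule
    (generated_submodule H_alg \<Delta> {L0 +>\<^bsub>H_alg\<^esub> (C_elem p \<zeta>s \<ominus>\<^bsub>H_alg\<^esub> H_const \<beta>)}) H_alg \<Delta>"
proof -
  let ?C = "C_smash p \<zeta>s - sconst \<beta>"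
  obtain \<mu> where \<mu>: "?C \<in> vanishing \<mu>" and gen: "\<And>L. admissible L \<Longrightarrow> ?C \<in> L \<Longrightarrow> vanishing \<mu> \<subseteq> L"
    using C_generates_vanishing[OF Xi_diff Xi_span card_Xi \<zeta>s] by blast
  have eq: "L0 +>\<^bsub>H_alg\<^esub> (C_elem p \<zeta>s \<ominus>\<^bsub>H_alg\<^esub> H_const \<beta>) = pr ?C"
    by (simp only: pr_def C_elem_eq H_generators q_diff)
  note van = submodule_image[OF admissible_vanishing, of \<mu>]
  have N: "generated_submodule H_alg \<Delta> {pr ?C} = pr ` vanishing \<mu>"
  proof (intro equalityI)
    show "generated_submodule H_alg \<Delta> {pr ?C} \<subseteq> pr ` vanishing \<mu>"
      unfolding generated_submodule_def using van(1) \<mu> by blast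
    show "pr ` vanishing \<mu> \<subseteq> generated_submodule H_alg \<Delta> {pr ?C}"
      unfolding generated_submodule_def
    proof (intro Inter_greatest)
      fix N assume "N \<in> {N. submodule N H_alg \<Delta> \<and> {pr ?C} \<subseteq> N}"
      then have "vanishing \<mu> \<subseteq> {F. pr F \<in> N}" by (intro gen submodule_preimage(1)) auto
      then show "pr ` vanishing \<mu> \<subseteq> N" by blast
    qed
  qed
  show ?thesis
    unfolding eq N maximal_submodule_def
  proof (intro conjI allI impI)
    have "pr 1 \<notin> pr ` vanishing \<mu>"
      using van(2) one_notin_vanishing[of \<mu>] by blast
    then show "pr ` vanishing \<mu> \<noteq> carrier \<Delta>" unfolding Delta_carrier by blast
    fix N' assume N': "submodule N' H_alg \<Delta> \<and> pr ` vanishing \<mu> \<subseteq> N'"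
    let ?L = "{F. pr F \<in> N'}"
    have L: "admissible ?L" "N' = pr ` ?L" using submodule_preimage N' by blast+
    show "N' = pr ` vanishing \<mu> \<or> N' = carrier \<Delta>"
    proof (cases "1 \<in> ?L")
      case True
      have "left_ideal ?L" using L(1) by (simp only: admissible_def)
      from left_idealD(3)[OF this True] have "F * 1 \<in> ?L" for F .
      then have "?L = UNIV" by auto
      then show ?thesis using L(2) by (simp add: Delta_carrier)
    next
      case False
      have "?L = vanishing \<mu>"
      proof (rule vanishing_maximal[OF L(1) False])
        from N' have "pr ` vanishing \<mu> \<subseteq> N'" ..
        then show "vanishing \<mu> \<subseteq> ?L" by (auto simp only: image_subset_iff)
      qed
      then show ?thesis using L(2) by simp
    qed
  qed (rule van(1))
qed

end

section \<open>Simple modules\<close>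

locale H_module = left_module H_alg M for M :: "('f::{finite, field} H_elem, 'm) module"
begin

definition sm :: "'f smash \<Rightarrow> 'm \<Rightarrow> 'm" where
  "sm F m = q F \<odot>\<^bsub>M\<^esub> m"

lemma sm_closed [simp]: "m \<in> carrier M \<Longrightarrow> sm F m \<in> carrier M"
  and sm_add: "m \<in> carrier M \<Longrightarrow> sm (F + G) m = sm F m \<oplus>\<^bsub>M\<^esub> sm G m"
  and sm_mult: "m \<in> carrier M \<Longrightarrow> sm (F * G) m = sm F (sm G m)"
  and sm_1 [simp]: "m \<in> carrier M \<Longrightarrow> sm 1 m = m"
  by (simp_all add: sm_def smult_closed q_add smult_l_distr smult_r_distr q_mult smult_assoc1 q_1 smult_one)

lemma sm_0 [simp]: "m \<in> carrier M \<Longrightarrow> sm 0 m = \<zero>\<^bsub>M\<^esub>"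
proof -
  assume m: "m \<in> carrier M"
  have "sm 0 m \<oplus>\<^bsub>M\<^esub> sm 0 m = sm 0 m \<oplus>\<^bsub>M\<^esub> \<zero>\<^bsub>M\<^esub>"
    using sm_add[OF m, of 0 0] m by simp
  then show ?thesis using m by (simp only: M.add.l_cancel sm_closed M.zero_closed)
qed

lemma sm_zero [simp]: "sm F \<zero>\<^bsub>M\<^esub> = \<zero>\<^bsub>M\<^esub>"
  using sm_mult[OF M.zero_closed, of F 0] by simp

lemma sm_eq_iff: "m \<in> carrier M \<Longrightarrow> sm F m = sm G m \<longleftrightarrow> sm (F - G) m = \<zero>\<^bsub>M\<^esub>"
proof -
  assume m: "m \<in> carrier M"
  have "sm F m = sm (F - G) m \<oplus>\<^bsub>M\<^esub> sm G m" using sm_add[OF m, of "F - G" G] by simp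
  then show ?thesis using m by (metis M.add.l_cancel_one sm_closed M.add.r_cancel_one')
qed

lemma sm_sum:
  assumes "finite I" "m \<in> carrier M"
  shows "sm (\<Sum>i\<in>I. F i) m = (\<Oplus>\<^bsub>M\<^esub>i\<in>I. sm (F i) m)"
  using assms(1) by (induction I rule: finite_induct) (simp_all add: assms(2) sm_add Pi_def)

lemma annihilator_left_ideal: "w \<in> carrier M \<Longrightarrow> left_ideal {F. sm F w = \<zero>\<^bsub>M\<^esub>}"
  by (simp add: left_ideal_def sm_add sm_mult)

text \<open>Used with L = \<open>UNIV\<close>, whose orbit fills a simple module, and with L =
  \<open>vanishing \<mu>\<close>, whose orbit turns out to be zero.\<close>

lemma submodule_orbit:
  assumes w: "w \<in> carrier M" and L: "left_ideal L"
  shows "submodule ((\<lambda>F. sm F w) ` L) H_alg M"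
proof (intro submodule.intro subgroup.intro submodule_axioms.intro)
  show "(\<lambda>F. sm F w) ` L \<subseteq> carrier (add_monoid M)" using w by auto
  show "\<one>\<^bsub>add_monoid M\<^esub> \<in> (\<lambda>F. sm F w) ` L"
    using left_idealD(1)[OF L] w by (intro image_eqI[of _ _ 0]) simp_all
  show "x \<otimes>\<^bsub>add_monoid M\<^esub> y \<in> (\<lambda>F. sm F w) ` L"
    if "x \<in> (\<lambda>F. sm F w) ` L" "y \<in> (\<lambda>F. sm F w) ` L" for x y
    using that left_idealD(2)[OF L] w by (auto simp: sm_add[symmetric])
  show "inv\<^bsub>add_monoid M\<^esub> x \<in> (\<lambda>F. sm F w) ` L" if x: "x \<in> (\<lambda>F. sm F w) ` L" for x
  proof -
    obtain F where F: "x = sm F w" "F \<in> L" using x by blast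
    have "sm (- F) w \<oplus>\<^bsub>M\<^esub> sm F w = \<zero>\<^bsub>M\<^esub>" using sm_add[OF w, of "- F" F] w by simp
    then have "\<ominus>\<^bsub>M\<^esub> x = sm (- F) w" using w by (simp add: F M.minus_equality)
    then show ?thesis using left_idealD(4)[OF L F(2)] by (simp add: a_inv_def)
  qed
  show "a \<odot>\<^bsub>M\<^esub> x \<in> (\<lambda>F. sm F w) ` L" if a: "a \<in> carrier H_alg" and x: "x \<in> (\<lambda>F. sm F w) ` L" for a x
  proof -
    obtain G where "a = q G" using a by (rule q_cases)
    moreover obtain F where "x = sm F w" "F \<in> L" using x by blast
    ultimately show ?thesis using left_idealD(3)[OF L] w sm_mult[OF w, of G F]
      by (intro image_eqI[of _ _ "G * F"]) (simp_all add: sm_def[of G])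
  qed
qed

lemma last_nonzero_power:
  assumes "w \<in> carrier M" "w \<noteq> \<zero>\<^bsub>M\<^esub>" "sm (F ^ n) w = \<zero>\<^bsub>M\<^esub>"
  shows "\<exists>k. sm (F ^ k) w \<noteq> \<zero>\<^bsub>M\<^esub> \<and> sm F (sm (F ^ k) w) = \<zero>\<^bsub>M\<^esub>"
  using assms(3)
proof (induction n)
  case (Suc n)
  then show ?case using assms(1) by (cases "sm (F ^ n) w = \<zero>\<^bsub>M\<^esub>") (auto simp: sm_mult)
qed (use assms in simp)

text \<open>Given a nonzero vector killed by the later operators, the last nonzero F^k w is killed
  by F too, and it is still killed by the others since they commute with F.\<close>

lemma common_kernel:
  assumes nil: "\<And>F m. F \<in> set Fs \<Longrightarrow> m \<in> carrier M \<Longrightarrow> sm (F ^ n) m = \<zero>\<^bsub>M\<^esub>"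
    and comm: "\<And>F G. F \<in> set Fs \<Longrightarrow> G \<in> set Fs \<Longrightarrow> F * G = G * F"
    and ne: "carrier M \<noteq> {\<zero>\<^bsub>M\<^esub>}"
  shows "\<exists>w\<in>carrier M. w \<noteq> \<zero>\<^bsub>M\<^esub> \<and> (\<forall>F\<in>set Fs. sm F w = \<zero>\<^bsub>M\<^esub>)"
  using nil comm
proof (induction Fs)
  case Nil
  then show ?case using ne M.zero_closed by auto
next
  case (Cons F Fs)
  have "\<exists>w\<in>carrier M. w \<noteq> \<zero>\<^bsub>M\<^esub> \<and> (\<forall>F\<in>set Fs. sm F w = \<zero>\<^bsub>M\<^esub>)"
    by (rule Cons.IH) (use Cons.prems in auto)
  then obtain w where w: "w \<in> carrier M" "w \<noteq> \<zero>\<^bsub>M\<^esub>"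
    "\<And>G. G \<in> set Fs \<Longrightarrow> sm G w = \<zero>\<^bsub>M\<^esub>"
    by blast
  obtain k where k: "sm (F ^ k) w \<noteq> \<zero>\<^bsub>M\<^esub>" "sm F (sm (F ^ k) w) = \<zero>\<^bsub>M\<^esub>"
    using last_nonzero_power[OF w(1,2)] Cons.prems(1)[of F w] w(1) by auto
  have "sm G (sm (F ^ k) w) = \<zero>\<^bsub>M\<^esub>" if G: "G \<in> set Fs" for G
  proof -
    have "F ^ k * G = G * F ^ k" by (rule commute_power) (use Cons.prems(2)[of F G] G in simp)
    then have "sm G (sm (F ^ k) w) = sm (F ^ k) (sm G w)"
      using w(1) by (simp only: sm_mult[symmetric])
    then show ?thesis using w(3)[OF G] by simp
  qed
  then show ?case using k w(1) by (intro bexI[of _ "sm (F ^ k) w"]) auto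
qed

end

lemma simple_module_dimension:
  fixes M :: "('f::{finite, field} H_elem, 'm) module" and \<xi> :: 'f
  assumes prim: "primitive_element p r \<xi>" and odd: "odd p"
    and simple: "simple_left_module H_alg M"
    and c: "c \<noteq> 0" "\<And>m. m \<in> carrier M \<Longrightarrow> (H_x [^]\<^bsub>H_alg\<^esub> p) \<odot>\<^bsub>M\<^esub> m = H_const c \<odot>\<^bsub>M\<^esub> m"
  shows "has_k_dimension M (p ^ r)"
proof -
  interpret primitive_element p r \<xi> by (rule prim)
  interpret H_module M using simple by (simp add: simple_left_module_def H_module_def)
  have ne: "carrier M \<noteq> {\<zero>\<^bsub>M\<^esub>}"
    and irred: "\<And>N. submodule N H_alg M \<Longrightarrow> N = {\<zero>\<^bsub>M\<^esub>} \<or> N = carrier M"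
    using simple by (auto simp: simple_left_module_def)
  have p0: "p > 0" using prime by (rule prime_gt_0_nat)
  \<comment> \<open>In characteristic p this gives x^p - c = (x - \<alpha>)^p, so x - \<alpha> is
    nilpotent on M.\<close>
  obtain \<alpha> where root: "\<alpha> ^ p = c" using nth_root_exists[OF p0] by blast
  have \<alpha>0: "\<alpha> \<noteq> 0" using root c(1) p0 by auto
  interpret delta_module p r \<xi> \<alpha>
    by unfold_locales (use prime odd of_nat_p \<alpha>0 in auto)
  define Fs where "Fs = (sx - sconst \<alpha>) # map (\<lambda>a. sgroup a - 1) (SOME as. set as = (UNIV :: 'f set))"
  have "\<exists>as. set as = (UNIV :: 'f set)" using finite_list[of "UNIV :: 'f set"] by simp
  then have "set (SOME as. set as = (UNIV :: 'f set)) = UNIV" by (rule someI_ex)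
  then have Fs: "set Fs = insert (sx - sconst \<alpha>) (range (\<lambda>a. sgroup a - 1))" by (simp add: Fs_def)
  have minus_pow: "(F - G) ^ p = F ^ p - G ^ p" if "F * G = G * F" for F G :: "'f smash"
    using freshmans_dream_commute[of F "- G" p] that prime p_smash odd by simp
  have gp: "sgroup a ^ n = sgroup (of_nat n * a)" for a :: 'f and n
    by (induction n) (simp_all add: sgroup_add distrib_right)
  have "\<exists>w\<in>carrier M. w \<noteq> \<zero>\<^bsub>M\<^esub> \<and> (\<forall>F\<in>set Fs. sm F w = \<zero>\<^bsub>M\<^esub>)"
  proof (rule common_kernel[OF _ _ ne])
    fix F m assume F: "F \<in> set Fs" and m: "m \<in> carrier M"
    show "sm (F ^ p) m = \<zero>\<^bsub>M\<^esub>"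
    proof (cases "F = sx - sconst \<alpha>")
      case True
      have "F ^ p = sx ^ p - sconst c"
        unfolding True root[symmetric] sconst_power by (rule minus_pow[OF sconst_central])
      moreover have "sm (sx ^ p) m = sm (sconst c) m"
        using c(2)[OF m] by (simp add: sm_def q_power H_generators)
      ultimately show ?thesis using sm_eq_iff[OF m] by simp
    next
      case False
      then obtain a where "F = sgroup a - 1" using F Fs by auto
      then have "F ^ p = 0" by (simp add: minus_pow gp of_nat_p)
      then show ?thesis using m by simp
    qed
  next
    fix F G assume "F \<in> set Fs" "G \<in> set Fs"
    moreover have "sgroup a * sgroup b = sgroup b * sgroup a" for a b :: 'f
      by (simp add: sgroup_add[symmetric] add.commute)
    moreover have "sgroup a * sconst \<alpha> = sconst \<alpha> * sgroup a" for a
      by (rule sconst_central)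
    ultimately show "F * G = G * F"
      by (auto simp: Fs left_diff_distrib right_diff_distrib sgroup_sx)
  qed
  then obtain w where w: "w \<in> carrier M" "w \<noteq> \<zero>\<^bsub>M\<^esub>" and wF: "\<And>F. F \<in> set Fs \<Longrightarrow> sm F w = \<zero>\<^bsub>M\<^esub>"
    by blast
  define L where "L = {F. sm F w = \<zero>\<^bsub>M\<^esub>}"
  have "sm (relator * F) w = \<zero>\<^bsub>M\<^esub>" for F
    using sm_0[OF w(1)] by (simp add: sm_def q_relator)
  then have L: "admissible L"
    using annihilator_left_ideal[OF w(1)] wF by (simp add: admissible_def L_def Fs)
  have "1 \<notin> L" using w by (simp add: L_def)
  then obtain \<mu> where \<mu>: "L \<subseteq> vanishing \<mu>" using admissible_subset_vanishing[OF L] by blast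
  have van: "left_ideal (vanishing \<mu>)" using admissible_vanishing by (simp add: admissible_def)
  \<comment> \<open>Otherwise w = F w for some F in \<open>vanishing \<mu>\<close>; then 1 - F
    annihilates w, so it lies in \<open>vanishing \<mu>\<close> as well, and so does 1. By
    simplicity the orbit is therefore zero, and the annihilator of w is all of
    \<open>vanishing \<mu>\<close>.\<close>
  have "(\<lambda>F. sm F w) ` vanishing \<mu> \<noteq> carrier M"
  proof
    assume "(\<lambda>F. sm F w) ` vanishing \<mu> = carrier M"
    then obtain F where F: "w = sm F w" "F \<in> vanishing \<mu>" using w(1) by blast
    then have "1 - F \<in> L" using sm_eq_iff[OF w(1), of 1 F] w(1) by (simp add: L_def)
    then have "1 - F + F \<in> vanishing \<mu>" using \<mu> F(2) left_idealD(2)[OF van] by blast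
    then show False using one_notin_vanishing by simp
  qed
  then have "(\<lambda>F. sm F w) ` vanishing \<mu> = {\<zero>\<^bsub>M\<^esub>}"
    using irred[OF submodule_orbit[OF w(1) van]] by blast
  then have "vanishing \<mu> \<subseteq> L" unfolding L_def by blast
  then have L_eq: "L = vanishing \<mu>" using \<mu> by blast
  have "left_ideal (UNIV :: 'f smash set)" by (simp add: left_ideal_def)
  then have "(\<lambda>F. sm F w) ` UNIV = {\<zero>\<^bsub>M\<^esub>} \<or> (\<lambda>F. sm F w) ` UNIV = carrier M"
    by (intro irred submodule_orbit w(1))
  moreover have "sm 1 w \<in> (\<lambda>F. sm F w) ` UNIV" by blast
  ultimately have orbit: "carrier M = range (\<lambda>F. sm F w)" using w by auto
  obtain l where l: "\<And>b b'. poly (\<psi> (l b)) (\<mu> + to_ac b') = (if b = b' then 1 else 0)"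
    using lagrange_basis[of \<mu>] by blast
  define n where "n = p ^ r"
  obtain e where "bij_betw e {..<n} (UNIV :: 'f set)"
    using ex_bij_betw_nat_finite[of "UNIV :: 'f set"] by (auto simp: n_def card_UNIV atLeast0LessThan)
  then have e_inj: "inj_on e {..<n}" and e_surj: "e ` {..<n} = UNIV"
    by (simp_all add: bij_betw_def)
  have all_e: "(\<forall>b. Q b) \<longleftrightarrow> (\<forall>j<n. Q (e j))" for Q
  proof -
    have "Q b" if "\<forall>j<n. Q (e j)" for b
    proof -
      have "b \<in> e ` {..<n}" by (simp only: e_surj UNIV_I)
      then show ?thesis using that by (elim imageE) simp
    qed
    then show ?thesis by blast
  qed
  have comb: "(\<Oplus>\<^bsub>M\<^esub>i\<in>{..<n}. H_const (d i) \<odot>\<^bsub>M\<^esub> sm (l (e i)) w) = sm (\<Sum>i<n. sconst (d i) * l (e i)) w" for d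
    using w(1) by (simp add: sm_sum sm_mult) (simp add: sm_def H_generators)
  have eval: "poly (\<psi> (\<Sum>i\<in>I. sconst (d i) * l (e i))) (\<mu> + to_ac b) =
      (\<Sum>i\<in>I. if e i = b then d i else 0)" if "finite I" for d I b
    using that by (induction I rule: finite_induct) (simp_all add: psi_0 psi_add psi_mult l)
  \<comment> \<open>Elements of M correspond to functions on \<mu> + F_q, so the coordinates of F w
    are the values of \<open>\<psi> F\<close> at these q points.\<close>
  have coord: "sm F w = sm (\<Sum>i<n. sconst (d i) * l (e i)) w \<longleftrightarrow>
      (\<forall>i<n. d i = poly (\<psi> F) (\<mu> + to_ac (e i)))" for F d
  proof -
    have "sm F w = sm (\<Sum>i<n. sconst (d i) * l (e i)) w \<longleftrightarrow>
        (\<forall>b. poly (\<psi> F) (\<mu> + to_ac b) = (\<Sum>i<n. if e i = b then d i else 0))"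
      using L_eq unfolding sm_eq_iff[OF w(1)] set_eq_iff L_def
      by (simp add: vanishing_def psi_diff eval)
    also have "\<dots> \<longleftrightarrow> (\<forall>j<n. poly (\<psi> F) (\<mu> + to_ac (e j)) = (\<Sum>i<n. if e i = e j then d i else 0))"
      by (rule all_e)
    also have "\<dots> \<longleftrightarrow> (\<forall>j<n. poly (\<psi> F) (\<mu> + to_ac (e j)) = d j)"
    proof -
      have "(\<Sum>i<n. if e i = e j then d i else 0) = d j" if "j < n" for j
      proof -
        have "(\<Sum>i<n. if e i = e j then d i else 0) = (\<Sum>i<n. if i = j then d i else 0)"
          using inj_on_eq_iff[OF e_inj] that by (intro sum.cong) auto
        then show ?thesis using that by simp
      qed
      then show ?thesis by simp
    qed
    finally show ?thesis by (simp add: eq_commute)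
  qed
  have "has_k_dimension M n"
    unfolding has_k_dimension_def
  proof (intro exI[of _ "\<lambda>i. sm (l (e i)) w"] conjI allI impI ballI)
    fix m assume "m \<in> carrier M"
    then obtain F where F: "m = sm F w" using orbit by blast
    define d where "d = restrict (\<lambda>i. poly (\<psi> F) (\<mu> + to_ac (e i))) {..<n}"
    show "\<exists>!d. d \<in> extensional {..<n} \<and>
        m = (\<Oplus>\<^bsub>M\<^esub>i\<in>{..<n}. H_const (d i) \<odot>\<^bsub>M\<^esub> sm (l (e i)) w)"
      unfolding F comb coord
    proof (rule ex1I[of _ d])
      fix d' assume "d' \<in> extensional {..<n} \<and> (\<forall>i<n. d' i = poly (\<psi> F) (\<mu> + to_ac (e i)))"
      then show "d' = d" by (intro extensionalityI[of _ "{..<n}"]) (auto simp: d_def)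
    qed (simp add: d_def)
  qed (use w in simp)
  then show ?thesis by (simp add: n_def)
qed

theorem proposition6p15:
  fixes p r :: nat
    and \<xi> :: "'f::{finite, field}"
    and \<alpha> :: "'f alg_closure"
  assumes "prime p" and "odd p" and "r > 1"
    and "card (UNIV :: 'f set) = p ^ r"
    and "range (\<lambda>n::nat. \<xi> ^ n) = UNIV - {0}"
    and "\<alpha> \<noteq> 0"
  shows "(\<forall>(\<beta> :: 'f alg_closure) \<zeta>s. distinct \<zeta>s \<and> set \<zeta>s = Xi \<xi> r \<longrightarrow>
            maximal_submodule
              (generated_submodule H_alg (Delta \<xi> r \<alpha>)
                 {Delta_ideal \<xi> r \<alpha> +>\<^bsub>H_alg\<^esub> (C_elem p \<zeta>s \<ominus>\<^bsub>H_alg\<^esub> H_const \<beta>)})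
              H_alg (Delta \<xi> r \<alpha>)) \<and>
         (\<forall>M :: ('f H_elem, 'm) module.
            simple_left_module H_alg M \<and>
            (\<exists>c. c \<noteq> 0 \<and> (\<forall>m\<in>carrier M. (H_x [^]\<^bsub>H_alg\<^esub> p) \<odot>\<^bsub>M\<^esub> m = H_const c \<odot>\<^bsub>M\<^esub> m)) \<longrightarrow>
            has_k_dimension M (p ^ r))"
proof -
  have prim: "primitive_element p r \<xi>"
    by unfold_locales (use assms in simp_all)
  interpret primitive_element p r \<xi> by (rule prim)
  interpret delta_module p r \<xi> \<alpha>
    by unfold_locales (use assms of_nat_p in simp_all)
  show ?thesis
    using C_maximal simple_module_dimension[OF prim assms(2)] by blast
qed

end
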